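(* (Generalized Arthurs--Goodman inequality.) Let $\rho$ and $\rho_{\mathrm{app}}$ be states of the system and of the apparatus, with largest and smallest eigenvalues $\lambda_{\max},\lambda_{\min}$ and $\mu_{\max},\mu_{\min}$ respectively, such that $\lambda_{\max}\mu_{\max}\neq\lambda_{\min}\mu_{\min}$. Let $A,B$ be observables of the system, let $A_{\mathrm{app}},B_{\mathrm{app}}$ be commuting meter observables of the apparatus, and let $U$ be a unitary on the composite system. If the measurement is unbiased for both $A$ and $B$, then $$\varepsilon(A)\,\varepsilon(B)\ \ge\ \frac{\lambda_{\max}\mu_{\max}+\lambda_{\min}\mu_{\min}}{2\bigl(\lambda_{\max}\mu_{\max}-\lambda_{\min}\mu_{\min}\bigr)}\,\bigl|\langle[A,B]\rangle_\rho\bigr| .$$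
   Context: The system and the apparatus have complex separable Hilbert spaces $\mathcal{H}$ and $\mathcal{K}$; the composite system has Hilbert space $\mathcal{H}\otimes\mathcal{K}$ and initial state $\rho\otimes\rho_{\mathrm{app}}$. States are positive semidefinite trace-class operators of trace one; observables are (bounded) Hermitian operators. In infinite dimension the smallest eigenvalue of a state is understood as the infimum of its spectrum, i.e. $0$. $\langle X\rangle_\rho:=\operatorname{Tr}[X\rho]$ and $[A,B]:=AB-BA$. $U$ is the unitary operator on $\mathcal{H}\otimes\mathcal{K}$ describing the measurement interaction. For $X=A,B$, the noise operator is $N_X:=U^\dagger(\mathbb{I}\otimes X_{\mathrm{app}})U-X\otimes\mathbb{I}$ and the error is $\varepsilon(X):=\sqrt{\operatorname{Tr}[(\rho\otimes\rho_{\mathrm{app}})N_X^2]}$. Unbiasedness for $X$ means that $\operatorname{Tr}[(\rho'\otimes\rho_{\mathrm{app}})N_X]=0$ for every state $\rho'$ of the system. *)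

theory Defs
  imports "HOL-Analysis.Analysis"
begin

text \<open>
  Complex inner product spaces are built on top of the real ones, so that norm, topology,
  completeness and bounded linearity are those of the library. As a real inner product space,
  a complex one carries the real part of its complex inner product.
  The complex inner product is antilinear in its first argument.
\<close>

class complex_inner = real_inner +
  fixes scaleC :: "complex \<Rightarrow> 'a \<Rightarrow> 'a"  (infixr "*\<^sub>C" 75)
    and cinner :: "'a \<Rightarrow> 'a \<Rightarrow> complex"
  assumes scaleC_add_right: "a *\<^sub>C (x + y) = a *\<^sub>C x + a *\<^sub>C y"
    and scaleC_add_left: "(a + b) *\<^sub>C x = a *\<^sub>C x + b *\<^sub>C x"
    and scaleC_scaleC: "a *\<^sub>C (b *\<^sub>C x) = (a * b) *\<^sub>C x"
    and scaleR_scaleC: "r *\<^sub>R x = complex_of_real r *\<^sub>C x"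
    and cinner_commute: "cinner x y = cnj (cinner y x)"
    and cinner_add_right: "cinner x (y + z) = cinner x y + cinner x z"
    and cinner_scaleC_right: "cinner x (a *\<^sub>C y) = a * cinner x y"
    and inner_eq_Re_cinner: "inner x y = Re (cinner x y)"

class hilbert_space = complex_inner + complete_space

class separable_hilbert_space = hilbert_space +
  assumes separable: "\<exists>D. countable D \<and> (\<forall>x. \<forall>e>0. \<exists>d\<in>D. dist d x < e)"

global_interpretation complex_vector: vector_space "scaleC :: complex \<Rightarrow> 'a \<Rightarrow> 'a::complex_inner"
proof
  fix x :: 'a
  have "1 *\<^sub>C x = 1 *\<^sub>R x" by (simp only: scaleR_scaleC of_real_1)
  then show "1 *\<^sub>C x = x" by simp
qed (simp_all add: scaleC_add_right scaleC_add_left scaleC_scaleC)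

definition finite_dimensional :: "'a::complex_inner itself \<Rightarrow> bool" where
  "finite_dimensional _ \<longleftrightarrow> (\<exists>B :: 'a set. finite B \<and> complex_vector.span B = UNIV)"


subsection \<open>Bounded operators\<close>

definition bounded_clinear :: "('a::complex_inner \<Rightarrow> 'b::complex_inner) \<Rightarrow> bool" where
  "bounded_clinear T \<longleftrightarrow> bounded_linear T \<and> (\<forall>c x. T (c *\<^sub>C x) = c *\<^sub>C T x)"

definition cadjoint :: "('a::complex_inner \<Rightarrow> 'b::complex_inner) \<Rightarrow> 'b \<Rightarrow> 'a" where
  "cadjoint T = (THE S. \<forall>x y. cinner (S y) x = cinner y (T x))"

definition hermitian :: "('a::complex_inner \<Rightarrow> 'a) \<Rightarrow> bool" where
  "hermitian T \<longleftrightarrow> bounded_clinear T \<and> (\<forall>x y. cinner (T x) y = cinner x (T y))"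

definition positive_semidefinite :: "('a::complex_inner \<Rightarrow> 'a) \<Rightarrow> bool" where
  "positive_semidefinite T \<longleftrightarrow> hermitian T \<and> (\<forall>x. 0 \<le> Re (cinner x (T x)))"

definition unitary :: "('a::complex_inner \<Rightarrow> 'a) \<Rightarrow> bool" where
  "unitary U \<longleftrightarrow> bounded_clinear U \<and> cadjoint U \<circ> U = id \<and> U \<circ> cadjoint U = id"

definition commutator :: "('a::complex_inner \<Rightarrow> 'a) \<Rightarrow> ('a \<Rightarrow> 'a) \<Rightarrow> 'a \<Rightarrow> 'a" where
  "commutator A B = (\<lambda>x. A (B x) - B (A x))"


subsection \<open>Spectrum and extreme eigenvalues\<close>

definition eigenvalue :: "('a::complex_inner \<Rightarrow> 'a) \<Rightarrow> complex \<Rightarrow> bool" where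
  "eigenvalue T z \<longleftrightarrow> (\<exists>x. x \<noteq> 0 \<and> T x = z *\<^sub>C x)"

definition spectrum :: "('a::complex_inner \<Rightarrow> 'a) \<Rightarrow> complex set" where
  "spectrum T = {z. \<nexists>S. bounded_clinear S \<and>
     (\<lambda>x. T x - z *\<^sub>C x) \<circ> S = id \<and> S \<circ> (\<lambda>x. T x - z *\<^sub>C x) = id}"

text \<open>
  The following two are meant for positive semidefinite trace-class operators, whose spectrum is
  real. In infinite dimension such an operator has a largest but not always a smallest eigenvalue;
  the infimum of the spectrum takes the place of the latter.
\<close>

definition largest_eigenvalue :: "('a::complex_inner \<Rightarrow> 'a) \<Rightarrow> real" where
  "largest_eigenvalue T = (GREATEST l. eigenvalue T (complex_of_real l))"

definition smallest_eigenvalue :: "('a::complex_inner \<Rightarrow> 'a) \<Rightarrow> real" where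
  "smallest_eigenvalue T =
     (if finite_dimensional TYPE('a) then (LEAST l. eigenvalue T (complex_of_real l))
      else Inf {l. complex_of_real l \<in> spectrum T})"


subsection \<open>Trace and states\<close>

definition orthonormal_basis :: "'a::complex_inner set \<Rightarrow> bool" where
  "orthonormal_basis E \<longleftrightarrow>
     (\<forall>e\<in>E. \<forall>f\<in>E. cinner e f = (if e = f then 1 else 0)) \<and> closure (complex_vector.span E) = UNIV"

definition operator_abs :: "('a::complex_inner \<Rightarrow> 'a) \<Rightarrow> 'a \<Rightarrow> 'a" where
  "operator_abs T = (THE P. positive_semidefinite P \<and> P \<circ> P = cadjoint T \<circ> T)"

definition trace_class :: "('a::complex_inner \<Rightarrow> 'a) \<Rightarrow> bool" where
  "trace_class T \<longleftrightarrow> bounded_clinear T \<and>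
     (\<exists>E. orthonormal_basis E \<and> (\<lambda>e. cinner e (operator_abs T e)) summable_on E)"

text \<open>For a trace-class operator the value does not depend on the chosen orthonormal basis;
  for other operators it has no meaning.\<close>

definition op_trace :: "('a::complex_inner \<Rightarrow> 'a) \<Rightarrow> complex" where
  "op_trace T = infsum (\<lambda>e. cinner e (T e)) (SOME E. orthonormal_basis E)"

definition state :: "('a::complex_inner \<Rightarrow> 'a) \<Rightarrow> bool" where
  "state \<rho> \<longleftrightarrow> positive_semidefinite \<rho> \<and> trace_class \<rho> \<and> op_trace \<rho> = 1"

definition expectation :: "('a::complex_inner \<Rightarrow> 'a) \<Rightarrow> ('a \<Rightarrow> 'a) \<Rightarrow> complex" where
  "expectation \<rho> X = op_trace (X \<circ> \<rho>)"


subsection \<open>Tensor products\<close>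

text \<open>
  A Hilbert space \<open>'t\<close> with a map \<open>\<tau>\<close> as below is a realization of the Hilbert space tensor product
  of \<open>'h\<close> and \<open>'k\<close>, with \<open>\<tau> x y\<close> as the elementary tensor of \<open>x\<close> and \<open>y\<close>; any two realizations are
  identified by a unique unitary that respects elementary tensors.
\<close>

definition hilbert_tensor ::
    "('h::hilbert_space \<Rightarrow> 'k::hilbert_space \<Rightarrow> 't::hilbert_space) \<Rightarrow> bool" where
  "hilbert_tensor \<tau> \<longleftrightarrow>
     (\<forall>x x' y. \<tau> (x + x') y = \<tau> x y + \<tau> x' y) \<and>
     (\<forall>x y y'. \<tau> x (y + y') = \<tau> x y + \<tau> x y') \<and>
     (\<forall>c x y. \<tau> (c *\<^sub>C x) y = c *\<^sub>C \<tau> x y) \<and>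
     (\<forall>c x y. \<tau> x (c *\<^sub>C y) = c *\<^sub>C \<tau> x y) \<and>
     (\<forall>x y x' y'. cinner (\<tau> x y) (\<tau> x' y') = cinner x x' * cinner y y') \<and>
     closure (complex_vector.span {\<tau> x y | x y. True}) = UNIV"

definition operator_tensor ::
    "('h::hilbert_space \<Rightarrow> 'k::hilbert_space \<Rightarrow> 't::hilbert_space) \<Rightarrow>
     ('h \<Rightarrow> 'h) \<Rightarrow> ('k \<Rightarrow> 'k) \<Rightarrow> 't \<Rightarrow> 't" where
  "operator_tensor \<tau> S T =
     (THE R. bounded_clinear R \<and> (\<forall>x y. R (\<tau> x y) = \<tau> (S x) (T y)))"


subsection \<open>Measurement\<close>

definition noise ::
    "('h::hilbert_space \<Rightarrow> 'k::hilbert_space \<Rightarrow> 't::hilbert_space) \<Rightarrow>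
     ('t \<Rightarrow> 't) \<Rightarrow> ('h \<Rightarrow> 'h) \<Rightarrow> ('k \<Rightarrow> 'k) \<Rightarrow> 't \<Rightarrow> 't" where
  "noise \<tau> U X X\<^sub>a\<^sub>p\<^sub>p =
     (\<lambda>v. (cadjoint U \<circ> operator_tensor \<tau> id X\<^sub>a\<^sub>p\<^sub>p \<circ> U) v - operator_tensor \<tau> X id v)"

text \<open>The trace under the square root is real and nonnegative; \<open>Re\<close> only adjusts the type.\<close>

definition measurement_error ::
    "('h::hilbert_space \<Rightarrow> 'k::hilbert_space \<Rightarrow> 't::hilbert_space) \<Rightarrow>
     ('h \<Rightarrow> 'h) \<Rightarrow> ('k \<Rightarrow> 'k) \<Rightarrow> ('t \<Rightarrow> 't) \<Rightarrow> ('h \<Rightarrow> 'h) \<Rightarrow> ('k \<Rightarrow> 'k) \<Rightarrow> real" where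
  "measurement_error \<tau> \<rho> \<rho>\<^sub>a\<^sub>p\<^sub>p U X X\<^sub>a\<^sub>p\<^sub>p =
     sqrt (Re (op_trace (operator_tensor \<tau> \<rho> \<rho>\<^sub>a\<^sub>p\<^sub>p \<circ> (noise \<tau> U X X\<^sub>a\<^sub>p\<^sub>p \<circ> noise \<tau> U X X\<^sub>a\<^sub>p\<^sub>p))))"

definition unbiased ::
    "('h::hilbert_space \<Rightarrow> 'k::hilbert_space \<Rightarrow> 't::hilbert_space) \<Rightarrow>
     ('k \<Rightarrow> 'k) \<Rightarrow> ('t \<Rightarrow> 't) \<Rightarrow> ('h \<Rightarrow> 'h) \<Rightarrow> ('k \<Rightarrow> 'k) \<Rightarrow> bool" where
  "unbiased \<tau> \<rho>\<^sub>a\<^sub>p\<^sub>p U X X\<^sub>a\<^sub>p\<^sub>p \<longleftrightarrow>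
     (\<forall>\<rho>'. state \<rho>' \<longrightarrow> op_trace (operator_tensor \<tau> \<rho>' \<rho>\<^sub>a\<^sub>p\<^sub>p \<circ> noise \<tau> U X X\<^sub>a\<^sub>p\<^sub>p) = 0)"

end

theory Submission
  imports Defs
begin

text \<open>
  Let \<open>\<sigma>\<close> be the composite state. As the meters commute and unbiasedness polarises to
  \<open>Tr[(Y \<otimes> \<rho>\<^sub>a\<^sub>p\<^sub>p) N] = 0\<close> for all \<open>Y\<close>, the noise operators satisfy
  \<open>Tr[\<sigma> [N\<^sub>A, N\<^sub>B]] = - \<langle>[A, B]\<rangle>\<close>. If \<open>m \<le> \<sigma> \<le> M\<close> in finite dimension, then
  \<open>m Tr[\<sigma> Z\<^sup>* Z] \<le> m M Tr[Z\<^sup>* Z] = m M Tr[Z Z\<^sup>*] \<le> M Tr[\<sigma> Z Z\<^sup>*]\<close>; for \<open>Z = s N\<^sub>A + \<i> N\<^sub>B\<close> this is a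
  quadratic inequality in \<open>s\<close> whose discriminant is the theorem. In infinite dimension \<open>m = 0\<close>,
  the inequality is trivial and the constant is \<open>1/2\<close>.

  Spectral theory of states is avoided: a Cholesky decomposition along an orthonormal basis writes
  a state as \<open>\<Sum>\<^sub>i |v\<^sub>i\<rangle>\<langle>v\<^sub>i|\<close> with \<open>\<Sum>\<^sub>i \<parallel>v\<^sub>i\<parallel>\<^sup>2\<close> finite, which suffices to evaluate all traces by Fubini.
\<close>

section \<open>Complex inner product spaces\<close>

text \<open>The constant arises as follows. Let a and b be the squared errors and let 2 |g| be the
  modulus of the commutator expectation. For Z and its adjoint the two weighted traces are
  quadratics in s that differ only in the sign of 2 s g, so (M - m) (s^2 a + b) + 2 (M + m) g s is
  nonnegative for all real s, and therefore (M + m) |g| is at most (M - m) sqrt(a b). The unweighted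
  trace in the middle of the chain is under control for every bounded Z only in finite dimension.
  Elsewhere trace one forces the infimum of the spectrum of a factor down to 0, so both cases end in
  the same quadratic inequality. The obstacle is that adjoint, absolute value and tensor product of
  operators are definite descriptions, and the trace uses a chosen basis: each must first be shown
  to denote what it should. Operators are therefore built from bounded sesquilinear forms by Riesz,
  identities are extended by density, and trace computations are reduced to sums over families of
  vectors that need not be orthogonal.\<close>

lemma cinner_add_left: "cinner (x + y) z = cinner x z + cinner y z"
  by (metis cinner_add_right cinner_commute complex_cnj_add)

lemma cinner_scaleC_left: "cinner (c *\<^sub>C x) y = cnj c * cinner x y"
  by (metis cinner_commute cinner_scaleC_right complex_cnj_mult)

lemma cinner_zero_right [simp]: "cinner x 0 = 0"
  using cinner_add_right [of x 0 0] by simp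

lemma cinner_zero_left [simp]: "cinner 0 x = 0"
  by (metis cinner_commute cinner_zero_right complex_cnj_zero)

lemma cinner_minus_right: "cinner x (- y) = - cinner x y"
  using cinner_add_right [of x y "- y"] by (simp add: add_eq_0_iff)

lemma cinner_minus_left: "cinner (- x) y = - cinner x y"
  using cinner_add_left [of x "- x" y] by (simp add: add_eq_0_iff)

lemma cinner_diff_right: "cinner x (y - z) = cinner x y - cinner x z"
  using cinner_add_right [of x y "- z"] by (simp add: cinner_minus_right)

lemma cinner_diff_left: "cinner (x - y) z = cinner x z - cinner y z"
  using cinner_add_left [of x "- y" z] by (simp add: cinner_minus_left)

lemma cinner_sum_right: "cinner x (\<Sum>i\<in>I. f i) = (\<Sum>i\<in>I. cinner x (f i))"
  by (induction I rule: infinite_finite_induct) (simp_all add: cinner_add_right)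

lemma cinner_sum_left: "cinner (\<Sum>i\<in>I. f i) x = (\<Sum>i\<in>I. cinner (f i) x)"
  by (induction I rule: infinite_finite_induct) (simp_all add: cinner_add_left)

lemma cinner_scaleR_right: "cinner x (r *\<^sub>R y) = of_real r * cinner x y"
  by (simp add: scaleR_scaleC cinner_scaleC_right)

lemma cinner_scaleR_left: "cinner (r *\<^sub>R x) y = of_real r * cinner x y"
  by (simp add: scaleR_scaleC cinner_scaleC_left)

lemmas cinner_simps = cinner_add_left cinner_add_right cinner_diff_left cinner_diff_right
  cinner_scaleC_left cinner_scaleC_right cinner_scaleR_left cinner_scaleR_right
  cinner_minus_left cinner_minus_right

lemma cinner_self: "cinner x x = of_real ((norm x)\<^sup>2)"
proof -
  have "Im (cinner x x) = 0"
    using cinner_commute [of x x] by (metis Im_eq_0 cnj.sel(2) equal_neg_zero)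
  then show ?thesis
    by (simp add: complex_eq_iff power2_norm_eq_inner inner_eq_Re_cinner)
qed

lemma Re_cinner_self: "Re (cinner x x) = (norm x)\<^sup>2"
  by (simp add: cinner_self)

lemma norm_scaleC: "norm (c *\<^sub>C x) = cmod c * norm x"
proof -
  have "of_real ((norm (c *\<^sub>C x))\<^sup>2) = complex_of_real ((cmod c * norm x)\<^sup>2)"
    unfolding cinner_self [symmetric] cinner_scaleC_left cinner_scaleC_right
    by (simp add: cinner_self power_mult_distrib flip: complex_norm_square)
  then have "(norm (c *\<^sub>C x))\<^sup>2 = (cmod c * norm x)\<^sup>2"
    using of_real_eq_iff by blast
  then show ?thesis by simp
qed

text \<open>After \<open>y\<close> is multiplied by the conjugate phase of \<open>cinner x y\<close>
  the inner product is real, so the real Cauchy-Schwarz inequality applies. If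
  \<open>cinner x y = 0\<close> the phase is 0, so its modulus is only bounded by 1.\<close>

lemma norm_cinner_le: "cmod (cinner x y) \<le> norm x * norm y"
proof -
  define c where "c = cnj (sgn (cinner x y))"
  have "of_real (cmod z) = cnj (sgn z) * z" for z
    by (cases "z = 0") (simp_all add: sgn_eq complex_norm_square field_simps
        power2_eq_square flip: complex_norm_square)
  then have "of_real (cmod (cinner x y)) = c * cinner x y"
    by (simp add: c_def)
  then have "cmod (cinner x y) = Re (cinner x (c *\<^sub>C y))"
    by (metis Re_complex_of_real cinner_scaleC_right)
  also have "\<dots> \<le> norm x * norm (c *\<^sub>C y)"
    using norm_cauchy_schwarz [of x "c *\<^sub>C y"] by (simp add: inner_eq_Re_cinner)
  also have "\<dots> \<le> norm x * norm y"
    by (intro mult_left_mono) (simp_all add: norm_scaleC c_def norm_sgn)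
  finally show ?thesis .
qed

lemma cinner_ext:
  assumes "\<And>z. cinner z x = cinner z y"
  shows "x = y"
proof -
  have "cinner (x - y) (x - y) = 0"
    using assms by (simp add: cinner_diff_right)
  then show ?thesis by (simp add: cinner_self)
qed

lemma cinner_ext_left:
  assumes "\<And>z. cinner x z = cinner y z"
  shows "x = y"
  by (rule cinner_ext) (metis assms cinner_commute)

lemma bounded_linear_cinner_right: "bounded_linear (cinner x)"
  by (rule bounded_linear_intro [where K = "norm x"])
    (simp_all add: cinner_simps scaleR_conv_of_real mult.commute norm_cinner_le
      order_trans [OF norm_cinner_le])

text \<open>The vehicle by which facts about basis vectors and elementary tensors reach the whole
  space: the set where \<open>P\<close> holds is a closed complex subspace.\<close>

lemma dense_span_induct [consumes 1, case_names base zero add scale closed]: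
  assumes "closure (complex_vector.span S) = UNIV"
    and "\<And>x. x \<in> S \<Longrightarrow> P x"
    and "P 0" and "\<And>x y. P x \<Longrightarrow> P y \<Longrightarrow> P (x + y)" and "\<And>c x. P x \<Longrightarrow> P (c *\<^sub>C x)"
    and "closed {x. P x}"
  shows "P x"
proof -
  have "P y" if "y \<in> complex_vector.span S" for y
    using that by (induction rule: complex_vector.span_induct_alt) (auto intro: assms)
  then have "closure (complex_vector.span S) \<subseteq> {x. P x}"
    by (intro closure_minimal assms) auto
  then show ?thesis using assms(1) by auto
qed

lemma dense_span_eqI:
  fixes f g :: "'a::complex_inner \<Rightarrow> complex"
  assumes S: "closure (complex_vector.span S) = UNIV"
    and f: "bounded_linear f" "\<And>c x. f (c *\<^sub>C x) = c * f x"
    and g: "bounded_linear g" "\<And>c x. g (c *\<^sub>C x) = c * g x"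
    and eq: "\<And>x. x \<in> S \<Longrightarrow> f x = g x"
  shows "f x = g x"
  using S
proof (induction x rule: dense_span_induct)
  case closed
  show ?case
    by (intro closed_Collect_eq linear_continuous_on f g)
qed (simp_all add: eq f g linear_simps(1)[OF f(1)] linear_simps(1)[OF g(1)]
      linear_simps(3)[OF f(1)] linear_simps(3)[OF g(1)])

subsection \<open>Bounded operators and adjoints\<close>

lemma bounded_clinearD:
  assumes "bounded_clinear T"
  shows "bounded_linear T" "T (x + y) = T x + T y" "T (x - y) = T x - T y" "T 0 = 0"
    "T (c *\<^sub>C x) = c *\<^sub>C T x" "T (r *\<^sub>R x) = r *\<^sub>R T x"
  using assms by (auto simp: bounded_clinear_def linear_simps)

lemma bounded_clinearI:
  assumes "\<And>x y. T (x + y) = T x + T y" and "\<And>c x. T (c *\<^sub>C x) = c *\<^sub>C T x"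
    and "\<And>x. norm (T x) \<le> norm x * K"
  shows "bounded_clinear T"
  unfolding bounded_clinear_def
  using assms by (auto intro!: bounded_linear_intro [where K = K] simp: scaleR_scaleC)

lemma bounded_clinear_bound:
  assumes "bounded_clinear T"
  obtains K where "K > 0" "\<And>x. norm (T x) \<le> norm x * K"
  using assms bounded_linear.pos_bounded unfolding bounded_clinear_def by blast

lemma bounded_clinear_id: "bounded_clinear id"
  by (rule bounded_clinearI [where K = 1]) auto

lemma bounded_clinear_compose:
  assumes "bounded_clinear S" "bounded_clinear T"
  shows "bounded_clinear (S \<circ> T)"
  using assms unfolding bounded_clinear_def comp_def by (auto intro: bounded_linear_compose)

lemma bounded_clinear_add:
  assumes "bounded_clinear S" "bounded_clinear T"
  shows "bounded_clinear (\<lambda>x. S x + T x)"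
  using assms unfolding bounded_clinear_def
  by (auto intro: bounded_linear_add simp: scaleC_add_right)

lemma bounded_clinear_scaleC:
  assumes "bounded_clinear T"
  shows "bounded_clinear (\<lambda>x. c *\<^sub>C T x)"
proof -
  obtain K where K: "\<And>x. norm (T x) \<le> norm x * K"
    using bounded_clinear_bound assms by blast
  show ?thesis
  proof (rule bounded_clinearI [where K = "cmod c * K"])
    show "norm (c *\<^sub>C T x) \<le> norm x * (cmod c * K)" for x
      using mult_left_mono [OF K [of x], of "cmod c"] by (simp add: norm_scaleC mult_ac)
  qed (simp_all add: bounded_clinearD[OF assms] scaleC_add_right scaleC_scaleC mult.commute)
qed

lemma bounded_clinear_diff:
  assumes "bounded_clinear S" "bounded_clinear T"
  shows "bounded_clinear (\<lambda>x. S x - T x)"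
  using assms unfolding bounded_clinear_def
  by (auto intro: bounded_linear_sub simp: complex_vector.scale_right_diff_distrib)

lemma bounded_clinear_rank_one: "bounded_clinear (\<lambda>x. cinner v x *\<^sub>C w)"
proof (rule bounded_clinearI [where K = "norm v * norm w"])
  show "norm (cinner v x *\<^sub>C w) \<le> norm x * (norm v * norm w)" for x
    using mult_right_mono [OF norm_cinner_le [of v x], of "norm w"] by (simp add: norm_scaleC mult_ac)
qed (simp_all add: cinner_simps scaleC_add_left scaleC_scaleC)

lemma bounded_clinear_ext:
  assumes S: "closure (complex_vector.span S) = UNIV"
    and "bounded_clinear F" "bounded_clinear G" and "\<And>x. x \<in> S \<Longrightarrow> F x = G x"
  shows "F = G"
proof
  fix x
  show "F x = G x"
    using S
  proof (induction x rule: dense_span_induct)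
    case closed
    show ?case
      by (intro closed_Collect_eq linear_continuous_on bounded_clinearD assms)
  qed (simp_all add: assms bounded_clinearD[OF assms(2)] bounded_clinearD[OF assms(3)])
qed

text \<open>The representing vector minimises \<open>(norm x)\<^sup>2 - 2 * f x\<close>.\<close>

lemma real_riesz:
  fixes f :: "'a::{real_inner, complete_space} \<Rightarrow> real"
  assumes f: "bounded_linear f"
  obtains u where "\<And>x. f x = inner u x"
proof -
  interpret f: bounded_linear f by fact
  obtain K where K: "\<And>x. \<bar>f x\<bar> \<le> norm x * K"
    using f.bounded by auto
  define J where "J x = (norm x)\<^sup>2 - 2 * f x" for x
  define d where "d = Inf (range J)"
  have J_lower: "J x \<ge> - K\<^sup>2" for x
  proof -
    have "(norm x)\<^sup>2 - 2 * (norm x * K) \<ge> - K\<^sup>2"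
      using zero_le_power2 [of "norm x - K"] by (simp add: power2_diff)
    with K [of x] show ?thesis unfolding J_def by linarith
  qed
  then have bdd: "bdd_below (range J)"
    by (rule bdd_belowI2)
  have dJ: "d \<le> J x" for x
    unfolding d_def by (rule cInf_lower [OF _ bdd]) simp
  have "\<exists>x. J x < d + 1 / Suc n" for n
    using cInf_lessD [of "range J" "d + 1 / Suc n"] d_def by auto
  then obtain X where X: "\<And>n. J (X n) < d + 1 / Suc n"
    by metis
  \<comment> \<open>Parallelogram law at the midpoint: the linear parts of \<open>J\<close> cancel,
    so nearly minimal points are close together and a minimising sequence is Cauchy.\<close>
  have para: "(norm (x - y))\<^sup>2 \<le> 2 * (J x - d) + 2 * (J y - d)" for x y
  proof -
    define m where "m = (1/2) *\<^sub>R (x + y)"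
    have "(norm (x - y))\<^sup>2 = 2 * J x + 2 * J y - 4 * J m"
      unfolding J_def power2_norm_eq_inner m_def
      by (simp add: f.add f.scaleR inner_add inner_diff inner_commute field_simps)
    also have "\<dots> \<le> 2 * J x + 2 * J y - 4 * d"
      using dJ [of m] by simp
    finally show ?thesis by (simp add: algebra_simps)
  qed
  have "Cauchy X"
  proof (rule metric_CauchyI)
    fix e :: real assume "e > 0"
    then obtain N where N: "1 / Suc N < e\<^sup>2 / 4"
      using nat_approx_posE [of "e\<^sup>2 / 4"] by (metis divide_pos_pos zero_less_numeral zero_less_power)
    have small: "J (X n) - d < e\<^sup>2 / 4" if "n \<ge> N" for n
    proof -
      have "1 / Suc n \<le> 1 / Suc N"
        using that by (intro divide_left_mono) auto
      then show ?thesis using X [of n] N by linarith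
    qed
    have "dist (X m) (X n) < e" if "m \<ge> N" "n \<ge> N" for m n
    proof -
      have "(norm (X m - X n))\<^sup>2 < e\<^sup>2"
        using para [of "X m" "X n"] small [OF that(1)] small [OF that(2)] by (simp add: algebra_simps)
      then show ?thesis
        using \<open>e > 0\<close> by (simp add: dist_norm power2_less_imp_less)
    qed
    then show "\<exists>M. \<forall>m\<ge>M. \<forall>n\<ge>M. dist (X m) (X n) < e" by blast
  qed
  then obtain u where u: "X \<longlonglongrightarrow> u"
    by (auto simp: Cauchy_convergent_iff convergent_def)
  have "(\<lambda>n. J (X n)) \<longlonglongrightarrow> J u"
    unfolding J_def by (intro tendsto_intros f.tendsto u)
  moreover have "(\<lambda>n. d + 1 / Suc n) \<longlonglongrightarrow> d + 0"
    by (intro tendsto_intros LIMSEQ_Suc lim_1_over_n)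
  ultimately have Ju: "J u \<le> d"
    using LIMSEQ_le [of "\<lambda>n. J (X n)" "J u" "\<lambda>n. d + 1 / Suc n" "d + 0"] X less_imp_le by auto
  show thesis
  proof
    fix h
    define g where "g = inner u h - f h"
    have quad: "0 \<le> t\<^sup>2 * (norm h)\<^sup>2 + 2 * t * g" for t
    proof -
      have "J (u + t *\<^sub>R h) - J u = t\<^sup>2 * (norm h)\<^sup>2 + 2 * t * g"
        unfolding J_def power2_norm_eq_inner g_def
        by (simp add: f.add f.scaleR inner_add inner_commute algebra_simps power2_eq_square)
      then show ?thesis using dJ [of "u + t *\<^sub>R h"] Ju by linarith
    qed
    \<comment> \<open>With \<open>n = (norm h)\<^sup>2\<close> the point \<open>- g / n\<close>
      would be the vertex of the quadratic; the added 1 avoids division by zero for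
      \<open>h = 0\<close> and still yields a negative multiple of \<open>g\<^sup>2\<close>.\<close>
    define n where "n = (norm h)\<^sup>2 + 1"
    have "n > 0" by (simp add: n_def add_nonneg_pos)
    have "0 \<le> n\<^sup>2 * ((- g / n)\<^sup>2 * (norm h)\<^sup>2 + 2 * (- g / n) * g)"
      using quad [of "- g / n"] by (intro mult_nonneg_nonneg) auto
    also have "\<dots> = g\<^sup>2 * (norm h)\<^sup>2 - 2 * n * g\<^sup>2"
      using \<open>n > 0\<close> by (simp add: field_simps power2_eq_square)
    also have "\<dots> = - (g\<^sup>2 * (n + 1))"
      by (simp add: n_def algebra_simps)
    finally have "g\<^sup>2 * (n + 1) \<le> 0" by simp
    with \<open>n > 0\<close> have "g = 0"
      by (simp add: mult_le_0_iff)
    then show "f h = inner u h" by (simp add: g_def)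
  qed
qed

text \<open>Complex homogeneity gives Im (f x) = - Re (f (\<i> x)), so the vector that represents
  the real part represents \<open>f\<close> itself.\<close>

lemma riesz:
  fixes f :: "'a::hilbert_space \<Rightarrow> complex"
  assumes f: "bounded_linear f" and scale: "\<And>c x. f (c *\<^sub>C x) = c * f x"
  obtains u where "\<And>x. f x = cinner u x"
proof -
  obtain u where u: "\<And>x. Re (f x) = inner u x"
    using real_riesz [OF bounded_linear_compose [OF bounded_linear_Re f]] by blast
  have "f x = cinner u x" for x
    using u [of x] u [of "\<i> *\<^sub>C x"]
    by (simp add: complex_eq_iff scale inner_eq_Re_cinner cinner_scaleC_right)
  then show thesis by (rule that)
qed

lemma bounded_linearI_complex:
  fixes f :: "'a::complex_inner \<Rightarrow> complex"
  assumes "\<And>x y. f (x + y) = f x + f y" and "\<And>c x. f (c *\<^sub>C x) = c * f x"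
    and "\<And>x. cmod (f x) \<le> norm x * K"
  shows "bounded_linear f"
  using assms by (intro bounded_linear_intro [where K = K]) (simp_all add: scaleR_scaleC scaleR_conv_of_real)

text \<open>Riesz in the first argument, for each fixed \<open>y\<close>; the conjugate turns
  antilinearity into linearity. Adjoints and operators on the tensor product are obtained from their
  matrix elements in this way.\<close>

lemma bounded_form_operator:
  fixes b :: "'a::hilbert_space \<Rightarrow> 'b::complex_inner \<Rightarrow> complex"
  assumes add1: "\<And>x x' y. b (x + x') y = b x y + b x' y"
    and scale1: "\<And>c x y. b (c *\<^sub>C x) y = cnj c * b x y"
    and add2: "\<And>x y y'. b x (y + y') = b x y + b x y'"
    and scale2: "\<And>c x y. b x (c *\<^sub>C y) = c * b x y"
    and bound: "\<And>x y. cmod (b x y) \<le> K * norm x * norm y" and "0 \<le> K"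
  obtains T where "bounded_clinear T" "\<And>x y. cinner x (T y) = b x y"
proof -
  have "\<exists>u. \<forall>x. cnj (b x y) = cinner u x" for y
  proof -
    have "bounded_linear (\<lambda>x. cnj (b x y))"
      by (rule bounded_linearI_complex [where K = "K * norm y"])
        (use bound [of _ y] in \<open>auto simp: add1 scale1 mult.commute mult.left_commute\<close>)
    then show ?thesis
      using riesz [of "\<lambda>x. cnj (b x y)"] by (auto simp: scale1)
  qed
  then obtain T where "\<And>x y. cnj (b x y) = cinner (T y) x" by metis
  then have T: "cinner x (T y) = b x y" for x y
    by (metis cinner_commute complex_cnj_cnj)
  have "norm (T y) \<le> norm y * K" for y
  proof (cases "T y = 0")
    case True
    then show ?thesis using \<open>0 \<le> K\<close> by simp
  next
    case False
    have "(norm (T y))\<^sup>2 = cmod (b (T y) y)"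
      unfolding T [symmetric] by (simp add: cinner_self norm_power)
    also have "\<dots> \<le> K * norm (T y) * norm y" by (rule bound)
    finally have "norm (T y) * norm (T y) \<le> norm (T y) * (norm y * K)"
      by (simp add: power2_eq_square mult.commute mult.left_commute)
    then show ?thesis using False by simp
  qed
  then have "bounded_clinear T"
    by (intro bounded_clinearI cinner_ext) (auto simp: T cinner_simps add2 scale2)
  then show thesis using T by (rule that)
qed

text \<open>\<open>cadjoint\<close> is a definite description, so an operator has to be produced
  before anything is known about it. The bounded form \<open>cinner (T x) y\<close> supplies one,
  and nondegeneracy of \<open>cinner\<close> makes it unique.\<close>

lemma cinner_cadjoint_left:
  fixes T :: "'a::hilbert_space \<Rightarrow> 'b::complex_inner"
  assumes "bounded_clinear T"
  shows "cinner (cadjoint T y) x = cinner y (T x)"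
    and bounded_clinear_cadjoint: "bounded_clinear (cadjoint T)"
proof -
  obtain K where K: "K > 0" "\<And>x. norm (T x) \<le> norm x * K"
    using bounded_clinear_bound assms by blast
  have "cmod (cinner (T x) y) \<le> K * norm x * norm y" for x y
    using order_trans [OF norm_cinner_le mult_right_mono [OF K(2), of "norm y"]]
    by (simp add: mult_ac)
  then obtain S where S: "bounded_clinear S" "\<And>x y. cinner x (S y) = cinner (T x) y"
    using K(1) by (rule_tac bounded_form_operator [of "\<lambda>x y. cinner (T x) y" K])
      (auto simp: bounded_clinearD [OF assms] cinner_simps)
  have S': "cinner (S y) x = cinner y (T x)" for x y
    by (metis S(2) cinner_commute)
  have "cadjoint T = S"
    unfolding cadjoint_def
  proof (rule the_equality)
    fix R assume "\<forall>x y. cinner (R y) x = cinner y (T x)"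
    then show "R = S"
      by (intro ext cinner_ext_left) (simp add: S')
  qed (simp add: S')
  then show "cinner (cadjoint T y) x = cinner y (T x)" "bounded_clinear (cadjoint T)"
    using S S' by auto
qed

lemma cinner_cadjoint_right:
  fixes T :: "'a::hilbert_space \<Rightarrow> 'b::complex_inner"
  assumes "bounded_clinear T"
  shows "cinner x (cadjoint T y) = cinner (T x) y"
  by (metis assms cinner_cadjoint_left cinner_commute)

lemma cadjoint_eqI:
  assumes "\<And>x y. cinner (S y) x = cinner y (T x)"
  shows "cadjoint T = S"
  unfolding cadjoint_def
proof (rule the_equality)
  fix R assume "\<forall>x y. cinner (R y) x = cinner y (T x)"
  then show "R = S"
    by (intro ext cinner_ext_left) (simp add: assms)
qed (simp add: assms)

lemma hermitianD:
  assumes "hermitian T"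
  shows "bounded_clinear T" "cinner (T x) y = cinner x (T y)" "cadjoint T = T"
    "cinner x (T x) = of_real (Re (cinner x (T x)))"
proof -
  show *: "bounded_clinear T" "cinner (T x) y = cinner x (T y)" for x y
    using assms by (auto simp: hermitian_def)
  show "cadjoint T = T"
    by (rule cadjoint_eqI) (rule *)
  have "cnj (cinner x (T x)) = cinner x (T x)"
    by (metis "*"(2) cinner_commute)
  then show "cinner x (T x) = of_real (Re (cinner x (T x)))"
    by (simp add: complex_eq_iff)
qed

section \<open>Sums over index sets\<close>

lemma has_sum_diff:
  fixes f g :: "'i \<Rightarrow> 'b::topological_ab_group_add"
  assumes "(f has_sum a) I" and "(g has_sum b) I"
  shows "((\<lambda>i. f i - g i) has_sum (a - b)) I"
  using has_sum_add [OF assms(1), of "\<lambda>i. - g i" "- b"] assms(2) by (simp add: has_sum_uminus)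

lemma l2_summable:
  fixes f g :: "'i \<Rightarrow> real"
  assumes f: "(\<lambda>i. (f i)\<^sup>2) summable_on I" and g: "(\<lambda>i. (g i)\<^sup>2) summable_on I"
  shows "(\<lambda>i. \<bar>f i * g i\<bar>) summable_on I"
    and "(\<Sum>\<^sub>\<infinity>i\<in>I. \<bar>f i * g i\<bar>) \<le> sqrt (\<Sum>\<^sub>\<infinity>i\<in>I. (f i)\<^sup>2) * sqrt (\<Sum>\<^sub>\<infinity>i\<in>I. (g i)\<^sup>2)"
proof -
  have "\<bar>a * b\<bar> \<le> a\<^sup>2 + b\<^sup>2" for a b :: real
  proof -
    have "2 * \<bar>a * b\<bar> \<le> a\<^sup>2 + b\<^sup>2"
      using sum_squares_bound [of "\<bar>a\<bar>" "\<bar>b\<bar>"] by (simp add: abs_mult mult.assoc)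
    then show ?thesis using abs_ge_zero [of "a * b"] by linarith
  qed
  then show *: "(\<lambda>i. \<bar>f i * g i\<bar>) summable_on I"
    by (intro summable_on_comparison_test [OF summable_on_add [OF f g]]) auto
  show "(\<Sum>\<^sub>\<infinity>i\<in>I. \<bar>f i * g i\<bar>) \<le> sqrt (\<Sum>\<^sub>\<infinity>i\<in>I. (f i)\<^sup>2) * sqrt (\<Sum>\<^sub>\<infinity>i\<in>I. (g i)\<^sup>2)"
  proof (rule infsum_le_finite_sums [OF *])
    fix F assume F: "finite F" "F \<subseteq> I"
    have "(\<Sum>i\<in>F. \<bar>f i * g i\<bar>) \<le> L2_set f F * L2_set g F"
      using L2_set_mult_ineq by (simp add: abs_mult)
    also have "\<dots> \<le> sqrt (\<Sum>\<^sub>\<infinity>i\<in>I. (f i)\<^sup>2) * sqrt (\<Sum>\<^sub>\<infinity>i\<in>I. (g i)\<^sup>2)"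
      unfolding L2_set_def using F
      by (intro mult_mono real_sqrt_le_mono finite_sum_le_infsum f g real_sqrt_ge_zero
          infsum_nonneg sum_nonneg) auto
    finally show "(\<Sum>i\<in>F. \<bar>f i * g i\<bar>) \<le> \<dots>" .
  qed
qed

lemma l2_summable_complex:
  fixes f g :: "'i \<Rightarrow> complex"
  assumes f: "(\<lambda>i. (cmod (f i))\<^sup>2) summable_on I" and g: "(\<lambda>i. (cmod (g i))\<^sup>2) summable_on I"
  shows "(\<lambda>i. cmod (f i * g i)) summable_on I"
    and "(\<Sum>\<^sub>\<infinity>i\<in>I. cmod (f i * g i)) \<le>
      sqrt (\<Sum>\<^sub>\<infinity>i\<in>I. (cmod (f i))\<^sup>2) * sqrt (\<Sum>\<^sub>\<infinity>i\<in>I. (cmod (g i))\<^sup>2)"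
  using l2_summable [OF f g] by (simp_all add: norm_mult)

text \<open>The bound \<open>g\<close> makes the double family absolutely summable, so both iterated
  sums equal the sum over the product. Row and column sums enter as known values: in the use below
  one family gives a trace in a basis, the other a sum over a dyadic family.\<close>

lemma fubini_has_sum:
  fixes f :: "'i \<Rightarrow> 'j \<Rightarrow> 'b::banach"
  assumes "\<And>i. i \<in> I \<Longrightarrow> (\<lambda>j. norm (f i j)) summable_on J"
    and "\<And>i. i \<in> I \<Longrightarrow> (\<Sum>\<^sub>\<infinity>j\<in>J. norm (f i j)) \<le> g i" and "g summable_on I"
    and "\<And>i. i \<in> I \<Longrightarrow> (f i has_sum a i) J"
    and "\<And>j. j \<in> J \<Longrightarrow> ((\<lambda>i. f i j) has_sum b j) I"
  shows "(b has_sum (\<Sum>\<^sub>\<infinity>i\<in>I. a i)) J" and "(a has_sum (\<Sum>\<^sub>\<infinity>i\<in>I. a i)) I"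
proof -
  define F where "F = (\<lambda>p. f (fst p) (snd p))"
  have "(\<lambda>p. norm (F p)) summable_on (I \<times> J)"
    unfolding Infinite_Sum.abs_summable_on_Sigma_iff F_def fst_conv snd_conv
  proof (intro conjI ballI)
    show "(\<lambda>i. norm (\<Sum>\<^sub>\<infinity>j\<in>J. norm (f i j))) summable_on I"
      by (rule Infinite_Sum.abs_summable_on_comparison_test' [OF \<open>g summable_on I\<close>])
        (simp add: assms infsum_nonneg)
  qed (use assms in auto)
  then obtain s where s: "(F has_sum s) (I \<times> J)"
    using Infinite_Sum.abs_summable_summable summable_on_def by blast
  have a: "(a has_sum s) I"
    by (rule has_sum_SigmaD [OF s]) (simp add: F_def assms)
  have "((\<lambda>(j, i). F (i, j)) has_sum s) (J \<times> I)"
    using s has_sum_swap [of "\<lambda>(i, j). F (i, j)"] by (simp add: case_prod_unfold)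
  then have "(b has_sum s) J"
    by (rule has_sum_SigmaD) (simp add: F_def assms)
  with a show "(b has_sum (\<Sum>\<^sub>\<infinity>i\<in>I. a i)) J" "(a has_sum (\<Sum>\<^sub>\<infinity>i\<in>I. a i)) I"
    by (simp_all add: infsumI)
qed

section \<open>Orthonormal bases\<close>

lemma orthonormal_basis_cinner:
  assumes "orthonormal_basis E" "e \<in> E" "f \<in> E"
  shows "cinner e f = (if e = f then 1 else 0)"
  using assms by (simp add: orthonormal_basis_def)

lemma norm_orthonormal_basis:
  assumes "orthonormal_basis E" "e \<in> E"
  shows "norm e = 1"
  using orthonormal_basis_cinner [OF assms assms(2)] Re_cinner_self [of e]
  by (simp add: power2_eq_1_iff) (smt (verit) norm_ge_zero)

lemma orthonormal_coefficient:
  assumes "orthonormal_basis E" "finite F" "F \<subseteq> E" "e \<in> F"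
  shows "cinner e (\<Sum>f\<in>F. c f *\<^sub>C f) = c e"
proof -
  have "cinner e (\<Sum>f\<in>F. c f *\<^sub>C f) = (\<Sum>f\<in>F. if f = e then c e else 0)"
    using assms unfolding cinner_sum_right
    by (intro sum.cong) (auto simp: cinner_simps orthonormal_basis_cinner [OF assms(1)] subsetD [OF assms(3)])
  then show ?thesis using assms by simp
qed

text \<open>Completing the square isolates the choice of coefficients: the Fourier coefficients are
  optimal, and for them this is Bessel's inequality.\<close>

lemma norm_diff_orthonormal_sum:
  assumes E: "orthonormal_basis E" and F: "finite F" "F \<subseteq> E"
  shows "(norm (x - (\<Sum>e\<in>F. c e *\<^sub>C e)))\<^sup>2 =
    (norm x)\<^sup>2 - (\<Sum>e\<in>F. (cmod (cinner e x))\<^sup>2) + (\<Sum>e\<in>F. (cmod (c e - cinner e x))\<^sup>2)"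
proof -
  define p where "p = (\<Sum>e\<in>F. c e *\<^sub>C e)"
  have pp: "cinner p p = (\<Sum>e\<in>F. cnj (c e) * c e)"
    by (subst (1) p_def)
      (simp add: cinner_sum_left cinner_simps p_def orthonormal_coefficient [OF E F])
  have px: "cinner p x = (\<Sum>e\<in>F. cnj (c e) * cinner e x)"
    by (simp add: p_def cinner_sum_left cinner_simps)
  then have xp: "cinner x p = (\<Sum>e\<in>F. c e * cnj (cinner e x))"
    by (subst cinner_commute) simp
  have "of_real ((norm (x - p))\<^sup>2) = cinner x x - cinner x p - cinner p x + cinner p p"
    unfolding cinner_self [symmetric] by (simp add: cinner_simps)
  also have "\<dots> = cinner x x - (\<Sum>e\<in>F. cinner e x * cnj (cinner e x)) +
      (\<Sum>e\<in>F. (c e - cinner e x) * cnj (c e - cinner e x))"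
    unfolding pp px xp
    by (simp add: algebra_simps sum.distrib sum_subtractf)
  also have "\<dots> = of_real ((norm x)\<^sup>2 - (\<Sum>e\<in>F. (cmod (cinner e x))\<^sup>2) +
      (\<Sum>e\<in>F. (cmod (c e - cinner e x))\<^sup>2))"
    unfolding complex_norm_square [symmetric] by (simp add: cinner_self)
  finally show ?thesis
    unfolding p_def of_real_eq_iff .
qed

text \<open>Density provides a finite combination \<open>p\<close> close to \<open>x\<close>.
  Fourier coefficients approximate at least as well as those of \<open>p\<close>, so every partial
  sum over a superset of its support is within \<epsilon> of the limit; Bessel bounds it from
  above.\<close>

lemma parseval:
  assumes E: "orthonormal_basis E"
  shows "((\<lambda>e. (cmod (cinner e x))\<^sup>2) has_sum (norm x)\<^sup>2) E"
proof (unfold has_sum_def, rule tendstoI)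
  fix \<epsilon> :: real assume "\<epsilon> > 0"
  have "x \<in> closure (complex_vector.span E)"
    using E by (simp add: orthonormal_basis_def)
  then obtain p where p: "p \<in> complex_vector.span E" "dist p x < sqrt \<epsilon>"
    using \<open>\<epsilon> > 0\<close> by (metis closure_approachable real_sqrt_gt_0_iff)
  then obtain F c where F: "finite F" "F \<subseteq> E" and pF: "p = (\<Sum>e\<in>F. c e *\<^sub>C e)"
    by (auto simp: complex_vector.span_explicit)
  have "dist (\<Sum>e\<in>G. (cmod (cinner e x))\<^sup>2) ((norm x)\<^sup>2) < \<epsilon>"
    if G: "finite G" "F \<subseteq> G" "G \<subseteq> E" for G
  proof -
    have "(\<Sum>e\<in>G. (cmod (cinner e x))\<^sup>2) \<le> (norm x)\<^sup>2"
      using norm_diff_orthonormal_sum [OF E G(1,3), of x "\<lambda>e. cinner e x"]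
      by simp (smt (verit) zero_le_power2)
    moreover have "(norm x)\<^sup>2 - (\<Sum>e\<in>F. (cmod (cinner e x))\<^sup>2) \<le> (norm (x - p))\<^sup>2"
      unfolding pF norm_diff_orthonormal_sum [OF E F] by (simp add: sum_nonneg)
    moreover have "(\<Sum>e\<in>F. (cmod (cinner e x))\<^sup>2) \<le> (\<Sum>e\<in>G. (cmod (cinner e x))\<^sup>2)"
      using G by (intro sum_mono2) auto
    moreover have "(norm (x - p))\<^sup>2 < \<epsilon>"
      using power_strict_mono [OF p(2), of 2] \<open>\<epsilon> > 0\<close>
      by (simp add: dist_norm norm_minus_commute)
    ultimately show ?thesis by (simp add: dist_real_def)
  qed
  then show "\<forall>\<^sub>F G in finite_subsets_at_top E. dist (\<Sum>e\<in>G. (cmod (cinner e x))\<^sup>2) ((norm x)\<^sup>2) < \<epsilon>"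
    unfolding eventually_finite_subsets_at_top using F by blast
qed

text \<open>Polarisation of Parseval's identity; the signs in \<open>?pol\<close> are those for an
  inner product antilinear in its first argument.\<close>

lemma parseval_cinner:
  assumes E: "orthonormal_basis E"
  shows "((\<lambda>e. cinner x e * cinner e y) has_sum cinner x y) E"
proof -
  note P = has_sum_of_real [OF parseval [OF E], where 'a = complex]
  let ?pol = "\<lambda>a b c d :: complex. (a - b) / 4 + \<i> * (c - d) / 4"
  have "((\<lambda>e. ?pol (of_real ((cmod (cinner e (x + y)))\<^sup>2)) (of_real ((cmod (cinner e (x - y)))\<^sup>2))
        (of_real ((cmod (cinner e (x - \<i> *\<^sub>C y)))\<^sup>2)) (of_real ((cmod (cinner e (x + \<i> *\<^sub>C y)))\<^sup>2)))
      has_sum ?pol (of_real ((norm (x + y))\<^sup>2)) (of_real ((norm (x - y))\<^sup>2))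
        (of_real ((norm (x - \<i> *\<^sub>C y))\<^sup>2)) (of_real ((norm (x + \<i> *\<^sub>C y))\<^sup>2))) E"
    by (intro has_sum_add has_sum_divide_const has_sum_cmult_right has_sum_diff P)
  moreover have "?pol (of_real ((cmod (cinner e (x + y)))\<^sup>2)) (of_real ((cmod (cinner e (x - y)))\<^sup>2))
        (of_real ((cmod (cinner e (x - \<i> *\<^sub>C y)))\<^sup>2)) (of_real ((cmod (cinner e (x + \<i> *\<^sub>C y)))\<^sup>2))
      = cinner x e * cinner e y" for e
    unfolding cinner_commute [of x e] complex_norm_square
    by (simp add: cinner_simps field_simps)
  moreover have "?pol (of_real ((norm (x + y))\<^sup>2)) (of_real ((norm (x - y))\<^sup>2))
        (of_real ((norm (x - \<i> *\<^sub>C y))\<^sup>2)) (of_real ((norm (x + \<i> *\<^sub>C y))\<^sup>2)) = cinner x y"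
    unfolding cinner_self [symmetric]
    by (simp add: cinner_simps field_simps)
  ultimately show ?thesis by simp
qed

lemma parseval_abs_summable:
  assumes E: "orthonormal_basis E"
  shows "(\<lambda>e. cmod (cinner x e * cinner e y)) summable_on E"
    and "(\<Sum>\<^sub>\<infinity>e\<in>E. cmod (cinner x e * cinner e y)) \<le> norm x * norm y"
proof -
  have x: "((\<lambda>e. (cmod (cinner x e))\<^sup>2) has_sum (norm x)\<^sup>2) E" for x
    using parseval [OF E] by (simp add: cinner_commute [of x] cong: has_sum_cong)
  note s = has_sum_imp_summable [OF x [of x]] has_sum_imp_summable [OF parseval [OF E, of y]]
  show "(\<lambda>e. cmod (cinner x e * cinner e y)) summable_on E"
    by (rule l2_summable_complex(1)) (fact s)+
  show "(\<Sum>\<^sub>\<infinity>e\<in>E. cmod (cinner x e * cinner e y)) \<le> norm x * norm y"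
    using l2_summable_complex(2) [OF s] by (simp add: infsumI [OF x] infsumI [OF parseval [OF E]])
qed

section \<open>Dyadic decompositions and the trace\<close>

text \<open>A weak form of writing \<open>T\<close> as the sum of the rank-one operators of the
  \<open>v i\<close>, with finite trace: convergence is only asked of matrix elements, and
  orthogonality is not. The index set is free so that tensor products can be indexed by
  pairs.\<close>

definition dyadic :: "('a::complex_inner \<Rightarrow> 'a) \<Rightarrow> 'i set \<Rightarrow> ('i \<Rightarrow> 'a) \<Rightarrow> bool" where
  "dyadic T I v \<longleftrightarrow> (\<lambda>i. (norm (v i))\<^sup>2) summable_on I \<and>
     (\<forall>x y. ((\<lambda>i. cinner x (v i) * cinner (v i) y) has_sum cinner x (T y)) I)"

text \<open>Both sums are iterated sums of the family
  \<open>cinner (cadjoint T (v i)) e * cinner e (cadjoint S (v i))\<close>: Parseval evaluates the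
  one over \<open>e\<close>, the decomposition the one over \<open>i\<close>. The common value does
  not mention \<open>E\<close>, so the trace is independent of the basis; moving an operator between
  \<open>S\<close> and \<open>T\<close> will give cyclicity.\<close>

lemma dyadic_trace:
  fixes S T :: "'a::hilbert_space \<Rightarrow> 'a"
  assumes \<sigma>: "dyadic \<sigma> I v" and E: "orthonormal_basis E"
    and S: "bounded_clinear S" and T: "bounded_clinear T"
  shows "((\<lambda>e. cinner (S e) (\<sigma> (T e))) has_sum
      (\<Sum>\<^sub>\<infinity>i\<in>I. cinner (cadjoint T (v i)) (cadjoint S (v i)))) E"
    and "((\<lambda>i. cinner (cadjoint T (v i)) (cadjoint S (v i))) has_sum
      (\<Sum>\<^sub>\<infinity>i\<in>I. cinner (cadjoint T (v i)) (cadjoint S (v i)))) I"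
proof -
  obtain K where K: "K > 0" "\<And>x. norm (cadjoint S x) \<le> norm x * K"
    using bounded_clinear_bound bounded_clinear_cadjoint [OF S] by blast
  obtain L where L: "L > 0" "\<And>x. norm (cadjoint T x) \<le> norm x * L"
    using bounded_clinear_bound bounded_clinear_cadjoint [OF T] by blast
  define f where "f = (\<lambda>i e. cinner (cadjoint T (v i)) e * cinner e (cadjoint S (v i)))"
  have "(\<Sum>\<^sub>\<infinity>e\<in>E. cmod (f i e)) \<le> (norm (v i))\<^sup>2 * (L * K)" for i
  proof -
    have "(\<Sum>\<^sub>\<infinity>e\<in>E. cmod (f i e)) \<le> norm (cadjoint T (v i)) * norm (cadjoint S (v i))"
      unfolding f_def by (rule parseval_abs_summable [OF E])
    also have "\<dots> \<le> (norm (v i) * L) * (norm (v i) * K)"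
      using K L by (intro mult_mono) (auto simp: less_imp_le)
    finally show ?thesis by (simp add: power2_eq_square mult_ac)
  qed
  moreover have "(\<lambda>i. (norm (v i))\<^sup>2 * (L * K)) summable_on I"
    using \<sigma> by (intro summable_on_cmult_left) (simp add: dyadic_def)
  moreover have "((\<lambda>i. f i e) has_sum cinner (S e) (\<sigma> (T e))) I" for e
    using \<sigma> by (simp add: dyadic_def f_def cinner_cadjoint_left T cinner_cadjoint_right S mult.commute)
  moreover have "(f i has_sum cinner (cadjoint T (v i)) (cadjoint S (v i))) E"
    "(\<lambda>e. cmod (f i e)) summable_on E" for i
    unfolding f_def by (rule parseval_cinner [OF E] parseval_abs_summable [OF E])+
  ultimately show "((\<lambda>e. cinner (S e) (\<sigma> (T e))) has_sum
      (\<Sum>\<^sub>\<infinity>i\<in>I. cinner (cadjoint T (v i)) (cadjoint S (v i)))) E"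
    and "((\<lambda>i. cinner (cadjoint T (v i)) (cadjoint S (v i))) has_sum
      (\<Sum>\<^sub>\<infinity>i\<in>I. cinner (cadjoint T (v i)) (cadjoint S (v i)))) I"
    using fubini_has_sum [of I f E "\<lambda>i. (norm (v i))\<^sup>2 * (L * K)"
        "\<lambda>i. cinner (cadjoint T (v i)) (cadjoint S (v i))" "\<lambda>e. cinner (S e) (\<sigma> (T e))"]
    by blast+
qed

text \<open>\<open>op_trace\<close> uses a basis picked by \<open>SOME\<close>, so the value has to
  be known for every basis; the existence of one makes the pick legitimate.\<close>

lemma op_trace_has_sum:
  assumes "orthonormal_basis (E :: 'a::complex_inner set)"
    and "\<And>E. orthonormal_basis (E :: 'a set) \<Longrightarrow> ((\<lambda>e. cinner e (T e)) has_sum s) E"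
  shows "op_trace T = s"
  unfolding op_trace_def using assms(2) someI [of orthonormal_basis, OF assms(1)] by (rule_tac infsumI)

lemma cadjoint_id: "cadjoint (id :: 'a::complex_inner \<Rightarrow> 'a) = id"
  by (rule cadjoint_eqI) simp

lemma dyadic_summable:
  assumes "dyadic \<sigma> I v" and S: "bounded_clinear S" and T: "bounded_clinear T"
  shows "(\<lambda>i. cinner (S (v i)) (T (v i))) summable_on I"
proof -
  obtain K where K: "K > 0" "\<And>x. norm (S x) \<le> norm x * K"
    using bounded_clinear_bound S by blast
  obtain L where L: "L > 0" "\<And>x. norm (T x) \<le> norm x * L"
    using bounded_clinear_bound T by blast
  show ?thesis
  proof (rule Infinite_Sum.abs_summable_summable, rule Infinite_Sum.abs_summable_on_comparison_test')
    show "(\<lambda>i. (norm (v i))\<^sup>2 * (K * L)) summable_on I"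
      using assms(1) by (intro summable_on_cmult_left) (simp add: dyadic_def)
    fix i
    have "cmod (cinner (S (v i)) (T (v i))) \<le> (norm (v i) * K) * (norm (v i) * L)"
      using K L by (intro order_trans [OF norm_cinner_le] mult_mono) (auto simp: less_imp_le)
    then show "cmod (cinner (S (v i)) (T (v i))) \<le> (norm (v i))\<^sup>2 * (K * L)"
      by (simp add: power2_eq_square mult_ac)
  qed
qed

text \<open>The equality of the two values is cyclicity of the trace. Both orders occur: error and
  unbiasedness put the state on the left, \<open>expectation\<close> puts it on the right.\<close>

lemma op_trace_dyadic:
  fixes Z :: "'a::hilbert_space \<Rightarrow> 'a"
  assumes \<sigma>: "dyadic \<sigma> I v" and E: "orthonormal_basis (E :: 'a set)" and Z: "bounded_clinear Z"
  shows "op_trace (\<sigma> \<circ> Z) = (\<Sum>\<^sub>\<infinity>i\<in>I. cinner (v i) (Z (v i)))"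
    and "op_trace (Z \<circ> \<sigma>) = (\<Sum>\<^sub>\<infinity>i\<in>I. cinner (v i) (Z (v i)))"
proof -
  show "op_trace (\<sigma> \<circ> Z) = (\<Sum>\<^sub>\<infinity>i\<in>I. cinner (v i) (Z (v i)))"
    using dyadic_trace(1) [OF \<sigma> _ bounded_clinear_id Z]
    by (intro op_trace_has_sum [OF E]) (simp add: cadjoint_id cinner_cadjoint_left Z)
  have "cadjoint (cadjoint Z) = Z"
    by (rule cadjoint_eqI) (simp add: cinner_cadjoint_right Z)
  then show "op_trace (Z \<circ> \<sigma>) = (\<Sum>\<^sub>\<infinity>i\<in>I. cinner (v i) (Z (v i)))"
    using dyadic_trace(1) [OF \<sigma> _ bounded_clinear_cadjoint [OF Z] bounded_clinear_id]
    by (intro op_trace_has_sum [OF E]) (simp add: cadjoint_id cinner_cadjoint_left Z)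
qed

lemma cinner_mult_commuted: "cinner x y * cinner y x = of_real ((cmod (cinner x y))\<^sup>2)"
  by (metis cinner_commute complex_norm_square)

lemma real_discriminant:
  fixes a b c :: real
  assumes nonneg: "\<And>s. 0 \<le> a * s\<^sup>2 - 2 * b * s + c" and "0 \<le> a"
  shows "b\<^sup>2 \<le> a * c"
proof (cases "a = 0")
  case True
  have "b = 0"
  proof (rule ccontr)
    assume "b \<noteq> 0"
    \<comment> \<open>For \<open>a = 0\<close> the function is affine in \<open>s\<close>; at this
      point its value is - 1.\<close>
    then show False
      using nonneg [of "(c + 1) / (2 * b)"] True by simp
  qed
  then show ?thesis using True by simp
next
  case False
  then show ?thesis
    using nonneg [of "b / a"] \<open>0 \<le> a\<close> by (simp add: field_simps power2_eq_square)
qed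

section \<open>Positive operators and states\<close>

lemma positive_semidefiniteD:
  assumes "positive_semidefinite T"
  shows "hermitian T" "bounded_clinear T" "0 \<le> Re (cinner x (T x))"
    "cinner (T x) y = cinner x (T y)"
  using assms by (auto simp: positive_semidefinite_def hermitian_def)

text \<open>The form is nonnegative at \<open>x - (of_real t * cnj z) *\<^sub>C y\<close>. The
  factor \<open>cnj z\<close> makes the cross term real, so a real discriminant gives the claim
  multiplied by \<open>(cmod z)\<^sup>2\<close>, which is cancelled when \<open>z\<close> is
  nonzero.\<close>

lemma positive_semidefinite_cauchy_schwarz:
  assumes T: "positive_semidefinite T"
  shows "(cmod (cinner x (T y)))\<^sup>2 \<le> Re (cinner x (T x)) * Re (cinner y (T y))"
proof -
  define z where "z = cinner x (T y)"
  define p where "p = Re (cinner x (T x))"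
  define q where "q = Re (cinner y (T y))"
  note lin = bounded_clinearD [OF positive_semidefiniteD(2) [OF T]]
  have p: "cinner x (T x) = of_real p" and q: "cinner y (T y) = of_real q"
    using hermitianD(4) [OF positive_semidefiniteD(1) [OF T]] by (simp_all add: p_def q_def)
  have zc: "cinner y (T x) = cnj z"
    unfolding z_def by (metis T cinner_commute positive_semidefiniteD(4))
  have "0 \<le> ((cmod z)\<^sup>2 * q) * t\<^sup>2 - 2 * (cmod z)\<^sup>2 * t + p" for t
  proof -
    define w where "w = x - (of_real t * cnj z) *\<^sub>C y"
    have "cinner w (T w) = (z * cnj z) * of_real q * (of_real t)\<^sup>2 - 2 * (z * cnj z) * of_real t + of_real p"
      by (simp add: w_def cinner_simps lin p q zc flip: z_def)
        (simp add: algebra_simps power2_eq_square)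
    then have "cinner w (T w) = of_real (((cmod z)\<^sup>2 * q) * t\<^sup>2 - 2 * (cmod z)\<^sup>2 * t + p)"
      by (simp flip: complex_norm_square)
    then show ?thesis
      using positive_semidefiniteD(3) [OF T, of w] by simp
  qed
  then have "((cmod z)\<^sup>2)\<^sup>2 \<le> ((cmod z)\<^sup>2 * q) * p"
    using positive_semidefiniteD(3) [OF T] by (intro real_discriminant) (auto simp: q_def)
  then have "(cmod z)\<^sup>2 * (cmod z)\<^sup>2 \<le> (cmod z)\<^sup>2 * (p * q)"
    by (simp add: power2_eq_square mult_ac)
  then have "(cmod z)\<^sup>2 \<le> p * q" if "z \<noteq> 0"
    using that mult_left_le_imp_le zero_less_norm_iff zero_less_power by blast
  then have "(cmod z)\<^sup>2 \<le> p * q"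
    using positive_semidefiniteD(3) [OF T] by (cases "z = 0") (auto simp: p_def q_def)
  then show ?thesis by (simp add: z_def p_def q_def)
qed

lemma positive_semidefinite_kernel:
  assumes T: "positive_semidefinite T" and "Re (cinner y (T y)) = 0"
  shows "T y = 0"
  by (rule cinner_ext) (use positive_semidefinite_cauchy_schwarz [OF T, of _ y] assms(2) in auto)

lemma has_sum_sum_finite:
  fixes f :: "'k \<Rightarrow> 'i \<Rightarrow> 'b::topological_comm_monoid_add"
  assumes "finite F" and "\<And>k. k \<in> F \<Longrightarrow> (f k has_sum a k) I"
  shows "((\<lambda>i. \<Sum>k\<in>F. f k i) has_sum (\<Sum>k\<in>F. a k)) I"
  using assms by (induction F) (auto intro: has_sum_add)

lemma square_summable_form:
  fixes v :: "'i \<Rightarrow> 'a::complex_inner"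
  assumes v: "(\<lambda>i. (norm (v i))\<^sup>2) summable_on I"
  shows "((\<lambda>i. cinner x (v i) * cinner (v i) y) has_sum
      (\<Sum>\<^sub>\<infinity>i\<in>I. cinner x (v i) * cinner (v i) y)) I"
    and "bounded_linear (\<lambda>y. \<Sum>\<^sub>\<infinity>i\<in>I. cinner x (v i) * cinner (v i) y)"
    and "(\<Sum>\<^sub>\<infinity>i\<in>I. cinner x (v i) * cinner (v i) (c *\<^sub>C y)) =
      c * (\<Sum>\<^sub>\<infinity>i\<in>I. cinner x (v i) * cinner (v i) y)"
proof -
  have bound: "cmod (cinner x (v i) * cinner (v i) y) \<le> norm x * norm y * (norm (v i))\<^sup>2" for i x y
  proof -
    have "cmod (cinner x (v i) * cinner (v i) y) \<le> (norm x * norm (v i)) * (norm (v i) * norm y)"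
      unfolding norm_mult by (intro mult_mono norm_cinner_le) auto
    then show ?thesis by (simp add: power2_eq_square mult_ac)
  qed
  have abs: "(\<lambda>i. cmod (cinner x (v i) * cinner (v i) y)) summable_on I" for x y
    by (rule Infinite_Sum.abs_summable_on_comparison_test' [OF _ bound])
      (intro summable_on_cmult_right v)
  show *: "((\<lambda>i. cinner x (v i) * cinner (v i) y) has_sum
      (\<Sum>\<^sub>\<infinity>i\<in>I. cinner x (v i) * cinner (v i) y)) I" for x y
    using abs by (simp add: Infinite_Sum.abs_summable_summable)
  show scale: "(\<Sum>\<^sub>\<infinity>i\<in>I. cinner x (v i) * cinner (v i) (c *\<^sub>C y)) =
      c * (\<Sum>\<^sub>\<infinity>i\<in>I. cinner x (v i) * cinner (v i) y)" for c y
    using has_sum_cmult_right [OF * [of x y], of c]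
    by (intro infsumI) (simp add: cinner_simps mult_ac)
  show "bounded_linear (\<lambda>y. \<Sum>\<^sub>\<infinity>i\<in>I. cinner x (v i) * cinner (v i) y)"
  proof (rule bounded_linearI_complex)
    show "(\<Sum>\<^sub>\<infinity>i\<in>I. cinner x (v i) * cinner (v i) (y + z)) =
      (\<Sum>\<^sub>\<infinity>i\<in>I. cinner x (v i) * cinner (v i) y) + (\<Sum>\<^sub>\<infinity>i\<in>I. cinner x (v i) * cinner (v i) z)"
      for y z
      using has_sum_add [OF * [of x y] * [of x z]]
      by (intro infsumI) (simp add: cinner_simps algebra_simps)
    fix y
    have "cmod (\<Sum>\<^sub>\<infinity>i\<in>I. cinner x (v i) * cinner (v i) y) \<le>
        (\<Sum>\<^sub>\<infinity>i\<in>I. cmod (cinner x (v i) * cinner (v i) y))"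
      using abs by (rule norm_infsum_bound)
    also have "\<dots> \<le> (\<Sum>\<^sub>\<infinity>i\<in>I. norm x * norm y * (norm (v i))\<^sup>2)"
      by (intro infsum_mono abs summable_on_cmult_right v bound)
    also have "\<dots> = norm y * (norm x * (\<Sum>\<^sub>\<infinity>i\<in>I. (norm (v i))\<^sup>2))"
      by (simp add: infsum_cmult_right' mult_ac)
    finally show "cmod (\<Sum>\<^sub>\<infinity>i\<in>I. cinner x (v i) * cinner (v i) y) \<le> \<dots>" .
  qed (rule scale)
qed

text \<open>Square-summability makes the series a bounded form, so agreement on a set with dense
  span suffices, extended in one argument at a time. Decompositions can thus be checked on basis
  vectors or elementary tensors.\<close>

lemma dyadicI_dense:
  assumes v: "(\<lambda>i. (norm (v i))\<^sup>2) summable_on I"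
    and D: "closure (complex_vector.span D) = UNIV" and T: "bounded_clinear T"
    and eq: "\<And>x y. x \<in> D \<Longrightarrow> y \<in> D \<Longrightarrow>
      ((\<lambda>i. cinner x (v i) * cinner (v i) y) has_sum cinner x (T y)) I"
  shows "dyadic T I v"
proof -
  define b where "b x y = (\<Sum>\<^sub>\<infinity>i\<in>I. cinner x (v i) * cinner (v i) y)" for x y
  note form = square_summable_form [OF v, folded b_def]
  have b_commute: "cnj (b x y) = b y x" for x y
  proof -
    have "cnj (cinner x (v i) * cinner (v i) y) = cinner y (v i) * cinner (v i) x" for i
      by (simp flip: cinner_commute)
    then show ?thesis by (simp add: b_def flip: infsum_cnj)
  qed
  have 1: "b x y = cinner x (T y)" if "y \<in> D" for x y
  proof -
    have "b y x = cinner (T y) x"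
    proof (rule dense_span_eqI [OF D form(2,3) bounded_linear_cinner_right])
      fix x assume "x \<in> D"
      have "b x y = cinner x (T y)"
        unfolding b_def by (intro infsumI eq \<open>x \<in> D\<close> \<open>y \<in> D\<close>)
      then show "b y x = cinner (T y) x"
        by (metis b_commute cinner_commute)
    qed (simp add: cinner_simps)
    then show ?thesis
      by (metis b_commute cinner_commute)
  qed
  have "b x y = cinner x (T y)" for x y
    by (rule dense_span_eqI [OF D form(2,3) bounded_linear_compose [OF bounded_linear_cinner_right]])
      (use T 1 in \<open>auto simp: cinner_simps bounded_clinearD\<close>)
  with form(1) show ?thesis
    using v by (simp add: dyadic_def)
qed

section \<open>Cholesky decomposition of a positive operator along a basis\<close>

text \<open>One step of a Cholesky decomposition; the pivot vanishes if \<open>cinner e (T e) = 0\<close>.\<close>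

definition pivot :: "('a::complex_inner \<Rightarrow> 'a) \<Rightarrow> 'a \<Rightarrow> 'a" where
  "pivot T e = (1 / sqrt (Re (cinner e (T e)))) *\<^sub>R T e"

definition deflate :: "('a::complex_inner \<Rightarrow> 'a) \<Rightarrow> 'a \<Rightarrow> 'a \<Rightarrow> 'a" where
  "deflate T e = (\<lambda>x. T x - cinner (pivot T e) x *\<^sub>C pivot T e)"

text \<open>Cauchy-Schwarz for the form of \<open>T\<close>, divided by the diagonal entry at
  \<open>e\<close>. It says exactly that subtracting the rank-one operator of the pivot keeps
  \<open>T\<close> positive.\<close>

lemma cinner_pivot_le:
  assumes T: "positive_semidefinite T"
  shows "(cmod (cinner x (pivot T e)))\<^sup>2 \<le> Re (cinner x (T x))"
proof (cases "Re (cinner e (T e)) = 0")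
  case True
  then show ?thesis
    using positive_semidefiniteD(3) [OF T] by (simp add: pivot_def)
next
  case False
  define q where "q = Re (cinner e (T e))"
  have "q > 0"
    using False positive_semidefiniteD(3) [OF T, of e] by (simp add: q_def)
  then have "(cmod (cinner x (pivot T e)))\<^sup>2 = (cmod (cinner x (T e)))\<^sup>2 / q"
    by (simp add: pivot_def cinner_simps norm_mult power_mult_distrib power_divide norm_divide flip: q_def)
  also have "\<dots> \<le> Re (cinner x (T x))"
    using positive_semidefinite_cauchy_schwarz [OF T, of x e] \<open>q > 0\<close>
    by (simp add: divide_le_eq flip: q_def)
  finally show ?thesis .
qed

lemma cinner_deflate:
  "cinner x (deflate T e y) = cinner x (T y) - cinner x (pivot T e) * cinner (pivot T e) y"
  by (simp add: deflate_def cinner_simps mult.commute)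

lemma positive_semidefinite_deflate:
  assumes T: "positive_semidefinite T"
  shows "positive_semidefinite (deflate T e)"
  unfolding positive_semidefinite_def hermitian_def
proof (intro conjI allI)
  show "bounded_clinear (deflate T e)"
    unfolding deflate_def
    by (intro bounded_clinear_diff positive_semidefiniteD(2) [OF T] bounded_clinear_rank_one)
  show "cinner (deflate T e x) y = cinner x (deflate T e y)" for x y
    unfolding cinner_commute [of "deflate T e x" y] cinner_deflate
    by (simp flip: cinner_commute) (metis T cinner_commute mult.commute positive_semidefiniteD(4))
  show "0 \<le> Re (cinner x (deflate T e x))" for x
  proof -
    show ?thesis
      using cinner_pivot_le [OF T, of x e] by (simp add: cinner_deflate cinner_mult_commuted)
  qed
qed

text \<open>\<open>deflate T e\<close> is the Schur complement of \<open>T\<close> at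
  \<open>e\<close>: the subtracted operator agrees with \<open>T\<close> on \<open>e\<close>. If the
  diagonal entry is 0, the pivot is 0 and \<open>T e = 0\<close> already by Cauchy-Schwarz.\<close>

lemma deflate_pivot_eq_0:
  assumes T: "positive_semidefinite T"
  shows "deflate T e e = 0"
proof (cases "Re (cinner e (T e)) = 0")
  case True
  then show ?thesis
    using positive_semidefinite_kernel [OF T True] by (simp add: deflate_def pivot_def)
next
  case False
  define q where "q = Re (cinner e (T e))"
  have q: "q > 0" "cinner (T e) e = of_real q"
    using False positive_semidefiniteD(1,3,4) [OF T] hermitianD(4) [of T e]
    by (simp_all add: q_def less_le)
  then have "complex_of_real (1 / sqrt q) * (of_real (1 / sqrt q) * of_real q) = 1"
    unfolding of_real_mult [symmetric] by (simp add: real_div_sqrt)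
  then show ?thesis
    by (simp add: deflate_def pivot_def cinner_simps q scaleR_scaleC complex_vector.scale_scale mult_ac
        flip: q_def)
qed

text \<open>Later elimination steps leave earlier ones intact, because the next pivot is a multiple
  of \<open>T e\<close> and \<open>T\<close> is self-adjoint.\<close>

lemma deflate_eq_0:
  assumes "positive_semidefinite T" and "T y = 0"
  shows "cinner (pivot T e) y = 0" "deflate T e y = 0"
proof -
  show "cinner (pivot T e) y = 0"
    using positive_semidefiniteD(4) [OF assms(1), of e y] assms(2) by (simp add: pivot_def cinner_simps)
  then show "deflate T e y = 0"
    by (simp add: deflate_def assms(2))
qed

primrec deflates :: "('a::complex_inner \<Rightarrow> 'a) \<Rightarrow> (nat \<Rightarrow> 'a) \<Rightarrow> nat \<Rightarrow> 'a \<Rightarrow> 'a" where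
  "deflates T c 0 = T"
| "deflates T c (Suc n) = deflate (deflates T c n) (c n)"

lemma positive_semidefinite_deflates:
  "positive_semidefinite T \<Longrightarrow> positive_semidefinite (deflates T c n)"
  by (induction n) (auto intro: positive_semidefinite_deflate)

lemma cinner_deflates:
  "cinner x (T y) = cinner x (deflates T c n y) +
    (\<Sum>k<n. cinner x (pivot (deflates T c k) (c k)) * cinner (pivot (deflates T c k) (c k)) y)"
  by (induction n) (auto simp: cinner_deflate)

lemma deflates_eq_0:
  assumes T: "positive_semidefinite T" and "deflates T c k y = 0" "k \<le> n"
  shows "deflates T c n y = 0"
  using \<open>k \<le> n\<close>
proof (induction n rule: dec_induct)
  case (step n)
  then show ?case
    by (simp add: deflate_eq_0 positive_semidefinite_deflates T)
qed (fact assms)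

text \<open>Only countably many basis vectors have a nonzero diagonal entry, so elimination along a
  sequence reaches them all; the others lie in the kernel of \<open>T\<close>. By Parseval the
  squared norms of the pivots add up to at most the trace.\<close>

lemma dyadic_exists:
  fixes T :: "'a::complex_inner \<Rightarrow> 'a"
  assumes T: "positive_semidefinite T" and E: "orthonormal_basis E"
    and tr: "(\<lambda>e. Re (cinner e (T e))) summable_on E"
  obtains v :: "nat \<Rightarrow> 'a" where "dyadic T UNIV v"
proof -
  have "countable {e \<in> E. Re (cinner e (T e)) \<noteq> 0}"
    using tr by (rule summable_countable_real)
  \<comment> \<open>\<open>c\<close> may repeat vectors: on its second appearance a vector is
    already annihilated and its pivot is 0.\<close>
  then obtain c :: "nat \<Rightarrow> 'a" where c: "{e \<in> E. Re (cinner e (T e)) \<noteq> 0} \<subseteq> range c"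
    by (metis empty_subsetI range_from_nat_into subset_refl)
  define v where "v = (\<lambda>k. pivot (deflates T c k) (c k))"
  note psd = positive_semidefinite_deflates [OF T, of c]
  have partial: "(\<Sum>k<n. (cmod (cinner x (v k)))\<^sup>2) \<le> Re (cinner x (T x))" for x n
  proof -
    have "Re (cinner x (T x)) = Re (cinner x (deflates T c n x)) + (\<Sum>k<n. (cmod (cinner x (v k)))\<^sup>2)"
      by (simp add: cinner_deflates [of x T x c n] cinner_mult_commuted v_def)
    then show ?thesis using positive_semidefiniteD(3) [OF psd] by simp
  qed
  have "(\<Sum>k\<in>F. (norm (v k))\<^sup>2) \<le> (\<Sum>\<^sub>\<infinity>e\<in>E. Re (cinner e (T e)))" if F: "finite F" for F
  proof -
    obtain n where n: "F \<subseteq> {..<n}"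
      using F finite_nat_iff_bounded by blast
    have "((\<lambda>e. \<Sum>k<n. (cmod (cinner e (v k)))\<^sup>2) has_sum (\<Sum>k<n. (norm (v k))\<^sup>2)) E"
      by (intro has_sum_sum_finite parseval [OF E]) auto
    then have "(\<Sum>k<n. (norm (v k))\<^sup>2) \<le> (\<Sum>\<^sub>\<infinity>e\<in>E. Re (cinner e (T e)))"
      using partial tr by (rule_tac has_sum_mono [OF _ has_sum_infsum]) auto
    moreover have "(\<Sum>k\<in>F. (norm (v k))\<^sup>2) \<le> (\<Sum>k<n. (norm (v k))\<^sup>2)"
      using n by (intro sum_mono2) auto
    ultimately show ?thesis by linarith
  qed
  then have summable: "(\<lambda>k. (norm (v k))\<^sup>2) summable_on UNIV"
    by (intro nonneg_bdd_above_summable_on bdd_aboveI2) auto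
  have "dyadic T UNIV v"
  proof (rule dyadicI_dense [OF summable])
    show "closure (complex_vector.span E) = UNIV"
      using E by (simp add: orthonormal_basis_def)
    show "bounded_clinear T"
      by (rule positive_semidefiniteD [OF T])
    fix x e assume "e \<in> E"
    show "((\<lambda>k. cinner x (v k) * cinner (v k) e) has_sum cinner x (T e)) UNIV"
    proof (cases "Re (cinner e (T e)) = 0")
      case True
      have "cinner e (v k) = 0" for k
      proof -
        have "(cmod (cinner e (v k)))\<^sup>2 \<le> (\<Sum>k<Suc k. (cmod (cinner e (v k)))\<^sup>2)"
          by (simp add: sum_nonneg)
        then have "(cmod (cinner e (v k)))\<^sup>2 \<le> 0"
          using partial [of e "Suc k"] True by linarith
        then show ?thesis by simp
      qed
      then have "cinner (v k) e = 0" for k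
        by (metis cinner_commute complex_cnj_zero)
      then show ?thesis
        using positive_semidefinite_kernel [OF T True] by simp
    next
      case False
      then obtain k where k: "e = c k"
        using c \<open>e \<in> E\<close> by blast
      \<comment> \<open>From step \<open>Suc k\<close> on the remainder annihilates \<open>e\<close>
        and the pivots are orthogonal to \<open>e\<close>, so the series is a finite sum and no
        limit of remainders has to be taken.\<close>
      then have "deflates T c (Suc k) e = 0"
        by (simp add: deflate_pivot_eq_0 psd)
      then have zero: "deflates T c n e = 0" if "n \<ge> Suc k" for n
        using that by (rule deflates_eq_0 [OF T])
      then have "cinner (v n) e = 0" if "n \<ge> Suc k" for n
        using that by (simp add: v_def deflate_eq_0 psd)
      then show ?thesis
        using cinner_deflates [of x T e c "Suc k"] zero [of "Suc k"]
        by (intro has_sum_finite_neutralI [of "{..<Suc k}"]) (auto simp: v_def)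
    qed
  qed
  then show thesis by (rule that)
qed

section \<open>States: their decompositions, and pure states as examples\<close>

lemma state_dyadic:
  fixes \<rho> :: "'a::complex_inner \<Rightarrow> 'a"
  assumes "state \<rho>"
  obtains E and v :: "nat \<Rightarrow> 'a" where "orthonormal_basis E"
    "((\<lambda>e. cinner e (\<rho> e)) has_sum 1) E" "dyadic \<rho> UNIV v"
proof -
  define E where "E = (SOME E :: 'a set. orthonormal_basis E)"
  have E: "orthonormal_basis E"
    using assms unfolding E_def state_def trace_class_def by (metis someI_ex)
  have "(\<Sum>\<^sub>\<infinity>e\<in>E. cinner e (\<rho> e)) = 1"
    using assms by (simp add: state_def op_trace_def E_def)
  \<comment> \<open>\<open>infsum\<close> defaults to 0 when the sum does not exist, so trace 1
    itself proves summability in the basis used by \<open>op_trace\<close>.\<close>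
  then have sum: "((\<lambda>e. cinner e (\<rho> e)) has_sum 1) E"
    by (metis has_sum_infsum infsum_not_exists zero_neq_one)
  then have "(\<lambda>e. Re (cinner e (\<rho> e))) summable_on E"
    using has_sum_Re has_sum_imp_summable by blast
  then show thesis
    using assms E sum dyadic_exists that unfolding state_def by metis
qed

lemma dyadic_rank_one: "dyadic (\<lambda>y. cinner x y *\<^sub>C x) UNIV (\<lambda>_ :: unit. x)"
  by (auto simp: dyadic_def cinner_simps mult.commute UNIV_unit intro!: has_sum_finiteI)

lemma positive_semidefinite_rank_one: "positive_semidefinite (\<lambda>y. cinner x y *\<^sub>C x)"
proof -
  have "cinner y x * cinner x y = of_real ((cmod (cinner x y))\<^sup>2)" for y
    by (subst mult.commute) (rule cinner_mult_commuted)
  then show ?thesis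
    by (auto simp: positive_semidefinite_def hermitian_def cinner_simps bounded_clinear_rank_one
        mult.commute simp flip: cinner_commute)
qed

text \<open>Unbiasedness can be applied to pure states only once they are known to be states. Trace
  class is defined through \<open>operator_abs\<close>, so the projection has to be recognised as
  its own unique positive square root.\<close>

lemma state_rank_one:
  fixes x :: "'a::hilbert_space"
  assumes "norm x = 1" and E: "orthonormal_basis (E :: 'a set)"
  shows "state (\<lambda>y. cinner x y *\<^sub>C x)"
proof -
  define P where "P = (\<lambda>y. cinner x y *\<^sub>C x)"
  have xx: "cinner x x = 1"
    using assms by (simp add: cinner_self)
  have P: "positive_semidefinite P"
    unfolding P_def by (rule positive_semidefinite_rank_one)
  then have Padj: "cadjoint P = P"
    by (intro hermitianD positive_semidefiniteD)
  have PP: "P \<circ> P = P"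
    by (simp add: P_def fun_eq_iff cinner_simps xx)
  have abs: "operator_abs P = P"
    unfolding operator_abs_def Padj PP
  proof (rule the_equality)
    fix R assume R: "positive_semidefinite R \<and> R \<circ> R = P"
    then have RR: "R (R y) = cinner x y *\<^sub>C x" for y
      by (auto simp: P_def fun_eq_iff)
    note lin = bounded_clinearD [OF positive_semidefiniteD(2) [OF conjunct1 [OF R]]]
    note herm = positive_semidefiniteD [OF conjunct1 [OF R]]
    define c where "c = Re (cinner x (R x))"
    \<comment> \<open>\<open>R x = R (R (R x))\<close> is a multiple of \<open>x\<close>, since the
      square of \<open>R\<close> projects onto \<open>x\<close>; positivity then selects the
      eigenvalue 1.\<close>
    have "R (R x) = x"
      by (simp add: RR xx)
    then have "R x = cinner x (R x) *\<^sub>C x"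
      using RR [of "R x"] by simp
    also have "cinner x (R x) = of_real c"
      unfolding c_def by (rule hermitianD(4) [OF herm(1)])
    finally have Rx: "R x = of_real c *\<^sub>C x" .
    have "cinner x (R (R x)) = 1"
      by (simp add: RR xx)
    then have "complex_of_real (c\<^sup>2) = 1"
      by (simp add: Rx lin cinner_simps xx power2_eq_square)
    then have "c\<^sup>2 = 1"
      using of_real_eq_1_iff by blast
    moreover have "0 \<le> c"
      unfolding c_def by (rule herm)
    ultimately have "c = 1"
      by (simp add: power2_eq_1_iff)
    show "R = P"
    proof
      fix y
      \<comment> \<open>The component orthogonal to \<open>x\<close>: the squared norm of
        \<open>R z\<close> is \<open>cinner z (R (R z))\<close>, which vanishes there.\<close>
      define z where "z = y - cinner x y *\<^sub>C x"
      have "cinner (R z) (R z) = 0"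
        by (simp add: herm(4) RR z_def cinner_simps xx)
      then have "R z = 0"
        by (simp add: cinner_self)
      then show "R y = P y"
        by (simp add: z_def lin Rx \<open>c = 1\<close> P_def)
    qed
  qed (use P PP in auto)
  have "((\<lambda>e. cinner (id e) (P (id e))) has_sum
      (\<Sum>\<^sub>\<infinity>i::unit. cinner (cadjoint id x) (cadjoint id x))) E"
    unfolding P_def by (rule dyadic_trace [OF dyadic_rank_one E bounded_clinear_id bounded_clinear_id])
  then have "(\<lambda>e. cinner e (P e)) summable_on E"
    by (auto dest: has_sum_imp_summable)
  then have "trace_class P"
    using E P abs by (auto simp: trace_class_def positive_semidefiniteD)
  moreover have "op_trace (P \<circ> id) = (\<Sum>\<^sub>\<infinity>i::unit. cinner x (id x))"
    unfolding P_def by (rule op_trace_dyadic [OF dyadic_rank_one E bounded_clinear_id])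
  then have "op_trace P = 1"
    by (simp add: xx UNIV_unit)
  ultimately show ?thesis
    using P by (simp add: state_def flip: P_def)
qed

section \<open>Tensor products\<close>

lemma closure_complex_span:
  fixes S :: "'a::complex_inner set"
  assumes "x \<in> closure (complex_vector.span S)" "y \<in> closure (complex_vector.span S)"
  shows "x + y \<in> closure (complex_vector.span S)" "c *\<^sub>C x \<in> closure (complex_vector.span S)"
proof -
  obtain X Y where X: "\<And>n. X n \<in> complex_vector.span S" "X \<longlonglongrightarrow> x"
    and Y: "\<And>n. Y n \<in> complex_vector.span S" "Y \<longlonglongrightarrow> y"
    using assms unfolding closure_sequential by blast
  have "(\<lambda>n. X n + Y n) \<longlonglongrightarrow> x + y"
    by (intro tendsto_add X Y)
  then show "x + y \<in> closure (complex_vector.span S)"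
    unfolding closure_sequential using X(1) Y(1)
    by (intro exI [of _ "\<lambda>n. X n + Y n"]) (simp add: complex_vector.span_add)
  have "bounded_linear (\<lambda>x::'a. c *\<^sub>C x)"
    using bounded_clinear_scaleC [OF bounded_clinear_id, of c] by (simp add: bounded_clinear_def)
  then have "(\<lambda>n. c *\<^sub>C X n) \<longlonglongrightarrow> c *\<^sub>C x"
    by (rule bounded_linear.tendsto) (rule X)
  then show "c *\<^sub>C x \<in> closure (complex_vector.span S)"
    unfolding closure_sequential using X(1)
    by (intro exI [of _ "\<lambda>n. c *\<^sub>C X n"]) (simp add: complex_vector.span_scale)
qed

lemma hermitianI_dense:
  assumes D: "closure (complex_vector.span D) = UNIV" and T: "bounded_clinear T"
    and eq: "\<And>x y. x \<in> D \<Longrightarrow> y \<in> D \<Longrightarrow> cinner (T x) y = cinner x (T y)"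
  shows "hermitian T"
proof -
  note lin = bounded_linear_cinner_right
    bounded_linear_compose [OF bounded_linear_cinner_right bounded_clinearD(1) [OF T]]
  have 1: "cinner (T x) y = cinner x (T y)" if "x \<in> D" for x y
    by (rule dense_span_eqI [OF D lin(1) _ lin(2)])
      (use that in \<open>auto simp: cinner_simps bounded_clinearD [OF T] eq\<close>)
  have "cinner (T x) y = cinner x (T y)" for x y
    by (rule dense_span_eqI [OF D lin(1) _ lin(2)])
      (use 1 in \<open>auto simp: cinner_simps bounded_clinearD [OF T], metis cinner_commute\<close>)
  with T show ?thesis by (simp add: hermitian_def)
qed

locale tensor_basis =
  fixes \<tau> :: "'h::hilbert_space \<Rightarrow> 'k::hilbert_space \<Rightarrow> 't::hilbert_space"
    and E :: "'h set" and F :: "'k set"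
  assumes tensor: "hilbert_tensor \<tau>"
    and E: "orthonormal_basis E" and F: "orthonormal_basis F"
begin

lemma tensor_simps:
  "\<tau> (x + x') y = \<tau> x y + \<tau> x' y" "\<tau> x (y + y') = \<tau> x y + \<tau> x y'"
  "\<tau> (c *\<^sub>C x) y = c *\<^sub>C \<tau> x y" "\<tau> x (c *\<^sub>C y) = c *\<^sub>C \<tau> x y"
  and cinner_tensor: "cinner (\<tau> x y) (\<tau> x' y') = cinner x x' * cinner y y'"
  using tensor by (simp_all add: hilbert_tensor_def)

lemma dense_tensor: "closure (complex_vector.span {\<tau> x y | x y. True}) = UNIV"
  using tensor by (simp add: hilbert_tensor_def)

lemma norm_tensor: "norm (\<tau> x y) = norm x * norm y"
proof -
  have "(norm (\<tau> x y))\<^sup>2 = (norm x * norm y)\<^sup>2"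
    unfolding Re_cinner_self [symmetric] cinner_tensor by (simp add: cinner_self power_mult_distrib)
  then show ?thesis by simp
qed

lemma bounded_clinear_tensor: "bounded_clinear (\<tau> x)" "bounded_clinear (\<lambda>x. \<tau> x y)"
  by (rule bounded_clinearI [where K = "norm x"], simp_all add: tensor_simps norm_tensor)
    (rule bounded_clinearI [where K = "norm y"], simp_all add: tensor_simps norm_tensor)

text \<open>Swapping the factors turns statements about the left factor into statements about the
  right one.\<close>

lemma flip: "tensor_basis (\<lambda>y x. \<tau> x y) F E"
proof
  have "{\<tau> x y | y x. True} = {\<tau> x y | x y. True}" by auto
  then show "hilbert_tensor (\<lambda>y x. \<tau> x y)"
    using tensor by (simp add: hilbert_tensor_def mult.commute)
qed (fact E F)+

lemma inj_on_tensor: "inj_on (\<lambda>(e, f). \<tau> e f) (E \<times> F)"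
proof (rule inj_onI, clarify)
  fix e f e' f' assume *: "e \<in> E" "f \<in> F" "e' \<in> E" "f' \<in> F" "\<tau> e f = \<tau> e' f'"
  then have "cinner e e' * cinner f f' = cinner e e * cinner f f"
    by (metis cinner_tensor)
  then show "e = e' \<and> f = f'"
    using * by (simp add: orthonormal_basis_cinner [OF E] orthonormal_basis_cinner [OF F] split: if_splits)
qed

text \<open>Totality is proved one factor at a time: \<open>\<tau> x f\<close> with \<open>f\<close>
  in the basis, then \<open>\<tau> x y\<close>, then everything. The closed span is a closed
  subspace and \<open>\<tau>\<close> is continuous in each argument.\<close>

lemma orthonormal_basis_tensor: "orthonormal_basis ((\<lambda>(e, f). \<tau> e f) ` (E \<times> F))"
  (is "orthonormal_basis ?G")
  unfolding orthonormal_basis_def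
proof (intro conjI ballI)
  fix g g' assume "g \<in> ?G" "g' \<in> ?G"
  then obtain e f e' f' where *: "e \<in> E" "f \<in> F" "e' \<in> E" "f' \<in> F" "g = \<tau> e f" "g' = \<tau> e' f'"
    by auto
  then have "g = g' \<longleftrightarrow> e = e' \<and> f = f'"
    using inj_onD [OF inj_on_tensor, of "(e, f)" "(e', f')"] by auto
  then show "cinner g g' = (if g = g' then 1 else 0)"
    using * by (auto simp: cinner_tensor orthonormal_basis_cinner [OF E] orthonormal_basis_cinner [OF F])
next
  let ?C = "closure (complex_vector.span ?G)"
  have closed: "closed {x. T x \<in> ?C}" if "bounded_clinear T" for T :: "'z::complex_inner \<Rightarrow> 't"
  proof -
    have "closed (T -` ?C)"
      by (intro closed_vimage linear_continuous_on bounded_clinearD that) simp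
    then show ?thesis by (simp add: vimage_def)
  qed
  have 0: "0 \<in> ?C"
    by (rule subsetD [OF closure_subset complex_vector.span_zero])
  have 1: "\<tau> x f \<in> ?C" if "f \<in> F" for x f
  proof -
    have "closure (complex_vector.span E) = UNIV"
      using E by (simp add: orthonormal_basis_def)
    then show ?thesis
    proof (induction x rule: dense_span_induct)
      case (base e)
      then have "\<tau> e f \<in> ?G" using that by auto
      then show ?case
        by (intro subsetD [OF closure_subset] complex_vector.span_base)
    next
      case zero
      show ?case using 0 by (simp add: bounded_clinearD [OF bounded_clinear_tensor(2)])
    qed (auto simp: tensor_simps closure_complex_span intro!: closed bounded_clinear_tensor)
  qed
  have 2: "\<tau> x y \<in> ?C" for x y
  proof -
    have "closure (complex_vector.span F) = UNIV"
      using F by (simp add: orthonormal_basis_def)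
    then show ?thesis
    proof (induction y rule: dense_span_induct)
      case zero
      show ?case using 0 by (simp add: bounded_clinearD [OF bounded_clinear_tensor(1)])
    qed (auto simp: tensor_simps closure_complex_span 1 intro!: closed bounded_clinear_tensor)
  qed
  have "z \<in> ?C" for z
    using dense_tensor
    by (induction z rule: dense_span_induct) (auto simp: 0 2 closure_complex_span)
  then show "?C = UNIV" by auto
qed

text \<open>The partial inner product: the identity tensored with the functional
  \<open>cinner y\<close>. Being an adjoint, it is available before any tensor product of operators
  exists.\<close>

definition contract :: "'k \<Rightarrow> 't \<Rightarrow> 'h" where
  "contract y = cadjoint (\<lambda>x. \<tau> x y)"

lemma cinner_contract: "cinner x (contract y z) = cinner (\<tau> x y) z"
  "cinner (contract y z) x = cinner z (\<tau> x y)"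
  by (simp_all add: contract_def cinner_cadjoint_right cinner_cadjoint_left bounded_clinear_tensor)

lemma bounded_clinear_contract: "bounded_clinear (contract y)"
  unfolding contract_def by (intro bounded_clinear_cadjoint bounded_clinear_tensor)

lemma contract_tensor: "contract y (\<tau> x y') = cinner y y' *\<^sub>C x"
  by (rule cinner_ext) (simp add: cinner_contract cinner_tensor cinner_simps)

text \<open>Parseval in the product basis, summed over \<open>E\<close> first.\<close>

lemma has_sum_contract: "((\<lambda>f. (norm (contract f z))\<^sup>2) has_sum (norm z)\<^sup>2) F"
proof -
  have "((\<lambda>(e, f). (cmod (cinner (\<tau> e f) z))\<^sup>2) has_sum (norm z)\<^sup>2) (E \<times> F)"
    using parseval [OF orthonormal_basis_tensor, of z]
    unfolding has_sum_reindex [OF inj_on_tensor] by (simp add: comp_def case_prod_unfold)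
  then have "((\<lambda>(f, e). (cmod (cinner (\<tau> e f) z))\<^sup>2) has_sum (norm z)\<^sup>2) (F \<times> E)"
    by (subst has_sum_swap) (simp add: case_prod_unfold)
  then show ?thesis
    by (rule has_sum_SigmaD) (use parseval [OF E] in \<open>simp flip: cinner_contract(1)\<close>)
qed

text \<open>A map prescribed on elementary tensors would have to be proved well defined and bounded.
  Instead the operator is read off the form that applies \<open>S\<close> slice by slice along
  \<open>F\<close>: the squared norms of the slices add up to that of the vector, so the form
  inherits the bound of \<open>S\<close>.\<close>

lemma tensor_left_exists:
  assumes S: "bounded_clinear S"
  shows "\<exists>R. bounded_clinear R \<and> (\<forall>x y. R (\<tau> x y) = \<tau> (S x) y)"
proof -
  obtain K where K: "K > 0" "\<And>x. norm (S x) \<le> norm x * K"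
    using bounded_clinear_bound S by blast
  define b where "b z w = (\<Sum>\<^sub>\<infinity>f\<in>F. cinner (contract f z) (S (contract f w)))" for z w
  note l2 = l2_summable [OF has_sum_imp_summable [OF has_sum_contract]
      has_sum_imp_summable [OF has_sum_contract]]
  have summand: "cmod (cinner (contract f z) (S (contract f w))) \<le>
      \<bar>norm (contract f z) * norm (contract f w)\<bar> * K" for f z w
    by (rule order_trans [OF norm_cinner_le order_trans [OF mult_left_mono [OF K(2)]]])
      (simp_all add: mult_ac)
  have abs: "(\<lambda>f. cmod (cinner (contract f z) (S (contract f w)))) summable_on F" for z w
    by (rule Infinite_Sum.abs_summable_on_comparison_test' [OF _ summand])
      (intro summable_on_cmult_left l2)
  have sum: "((\<lambda>f. cinner (contract f z) (S (contract f w))) has_sum b z w) F" for z w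
    unfolding b_def using abs by (simp add: Infinite_Sum.abs_summable_summable)
  have b_eqI: "b z w = s" if "((\<lambda>f. cinner (contract f z) (S (contract f w))) has_sum s) F" for z w s
    unfolding b_def using that by (rule infsumI)
  note lin = bounded_clinearD [OF S] bounded_clinearD [OF bounded_clinear_contract] cinner_simps
  obtain R where R: "bounded_clinear R" "\<And>z w. cinner z (R w) = b z w"
  proof (rule bounded_form_operator [of b K])
    fix z z' w w' c
    show "b (z + z') w = b z w + b z' w"
      using has_sum_add [OF sum sum] by (intro b_eqI) (simp add: lin)
    show "b z (w + w') = b z w + b z w'"
      using has_sum_add [OF sum sum] by (intro b_eqI) (simp add: lin)
    show "b (c *\<^sub>C z) w = cnj c * b z w"
      using has_sum_cmult_right [OF sum] by (intro b_eqI) (simp add: lin)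
    show "b z (c *\<^sub>C w) = c * b z w"
      using has_sum_cmult_right [OF sum] by (intro b_eqI) (simp add: lin)
    have "cmod (b z w) \<le> (\<Sum>\<^sub>\<infinity>f\<in>F. cmod (cinner (contract f z) (S (contract f w))))"
      unfolding b_def by (rule norm_infsum_bound [OF abs])
    also have "\<dots> \<le> (\<Sum>\<^sub>\<infinity>f\<in>F. \<bar>norm (contract f z) * norm (contract f w)\<bar> * K)"
      by (intro infsum_mono abs summable_on_cmult_left l2 summand)
    also have "\<dots> = (\<Sum>\<^sub>\<infinity>f\<in>F. \<bar>norm (contract f z) * norm (contract f w)\<bar>) * K"
      by (rule infsum_cmult_left')
    also have "\<dots> \<le> (norm z * norm w) * K"
      using l2(2) [of z w] K(1) by (intro mult_right_mono) (simp_all add: infsumI [OF has_sum_contract])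
    finally show "cmod (b z w) \<le> K * norm z * norm w"
      by (simp add: mult_ac)
  qed (use K in auto)
  have "R (\<tau> x y) = \<tau> (S x) y" for x y
  proof (rule cinner_ext)
    fix z
    have "((\<lambda>f. cinner (cadjoint (\<tau> (S x)) z) f * cinner f y) has_sum
        cinner (cadjoint (\<tau> (S x)) z) y) F"
      by (rule parseval_cinner [OF F])
    then have "b z (\<tau> x y) = cinner z (\<tau> (S x) y)"
      by (intro b_eqI)
        (simp add: contract_tensor lin cinner_contract cinner_cadjoint_left bounded_clinear_tensor mult.commute)
    then show "cinner z (R (\<tau> x y)) = cinner z (\<tau> (S x) y)"
      by (simp add: R)
  qed
  with R show ?thesis by blast
qed

text \<open>Existence comes from acting on one factor at a time, on the second through the swapped
  locale; uniqueness comes from density. The definite description in \<open>operator_tensor\<close>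
  demands both.\<close>

lemma operator_tensor:
  assumes S: "bounded_clinear S" and T: "bounded_clinear T"
  shows "bounded_clinear (operator_tensor \<tau> S T)"
    and "operator_tensor \<tau> S T (\<tau> x y) = \<tau> (S x) (T y)"
proof -
  interpret flip: tensor_basis "\<lambda>y x. \<tau> x y" F E
    by (rule flip)
  obtain R where R: "bounded_clinear R" "\<And>x y. R (\<tau> x y) = \<tau> (S x) y"
    using tensor_left_exists [OF S] by blast
  obtain Q where Q: "bounded_clinear Q" "\<And>x y. Q (\<tau> x y) = \<tau> x (T y)"
    using flip.tensor_left_exists [OF T] by blast
  have "\<exists>!R. bounded_clinear R \<and> (\<forall>x y. R (\<tau> x y) = \<tau> (S x) (T y))"
  proof (rule ex1I [of _ "R \<circ> Q"])
    show "bounded_clinear (R \<circ> Q) \<and> (\<forall>x y. (R \<circ> Q) (\<tau> x y) = \<tau> (S x) (T y))"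
      using R Q by (auto intro: bounded_clinear_compose)
    then show "R' = R \<circ> Q" if "bounded_clinear R' \<and> (\<forall>x y. R' (\<tau> x y) = \<tau> (S x) (T y))" for R'
      using that by (intro bounded_clinear_ext [OF dense_tensor]) auto
  qed
  from theI' [OF this]
  show "bounded_clinear (operator_tensor \<tau> S T)" "operator_tensor \<tau> S T (\<tau> x y) = \<tau> (S x) (T y)"
    by (simp_all add: operator_tensor_def)
qed

lemma hermitian_operator_tensor:
  assumes S: "hermitian S" and T: "hermitian T"
  shows "hermitian (operator_tensor \<tau> S T)"
proof (rule hermitianI_dense [OF dense_tensor])
  note ot = operator_tensor [OF hermitianD(1) [OF S] hermitianD(1) [OF T]]
  show "bounded_clinear (operator_tensor \<tau> S T)" by (rule ot)
  fix z w assume "z \<in> {\<tau> x y | x y. True}" "w \<in> {\<tau> x y | x y. True}"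
  then show "cinner (operator_tensor \<tau> S T z) w = cinner z (operator_tensor \<tau> S T w)"
    by (auto simp: ot(2) cinner_tensor hermitianD(2) [OF S] hermitianD(2) [OF T])
qed

lemma operator_tensor_compose:
  assumes "bounded_clinear S" "bounded_clinear S'" "bounded_clinear T" "bounded_clinear T'"
  shows "operator_tensor \<tau> S T \<circ> operator_tensor \<tau> S' T' = operator_tensor \<tau> (S \<circ> S') (T \<circ> T')"
  by (rule bounded_clinear_ext [OF dense_tensor])
    (auto simp: operator_tensor bounded_clinear_compose assms)

lemma dyadic_operator_tensor:
  assumes v: "dyadic \<rho> I v" and w: "dyadic \<rho>' J w"
    and lin: "bounded_clinear \<rho>" "bounded_clinear \<rho>'"
  shows "dyadic (operator_tensor \<tau> \<rho> \<rho>') (I \<times> J) (\<lambda>p. \<tau> (v (fst p)) (w (snd p)))"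
proof (rule dyadicI_dense [OF _ dense_tensor operator_tensor(1) [OF lin]])
  define u where "u = (\<lambda>p. \<tau> (v (fst p)) (w (snd p)))"
  have v2: "(\<lambda>i. (norm (v i))\<^sup>2) summable_on I" and w2: "(\<lambda>i. (norm (w i))\<^sup>2) summable_on J"
    and v1: "\<And>x y. ((\<lambda>i. cinner x (v i) * cinner (v i) y) has_sum cinner x (\<rho> y)) I"
    and w1: "\<And>x y. ((\<lambda>i. cinner x (w i) * cinner (w i) y) has_sum cinner x (\<rho>' y)) J"
    using v w by (simp_all add: dyadic_def)
  have "(\<lambda>p. (norm (u p))\<^sup>2) summable_on I \<times> J"
  proof (rule summable_on_SigmaI)
    show "((\<lambda>j. (norm (u (i, j)))\<^sup>2) has_sum (norm (v i))\<^sup>2 * (\<Sum>\<^sub>\<infinity>j\<in>J. (norm (w j))\<^sup>2)) J" for i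
      unfolding u_def fst_conv snd_conv norm_tensor power_mult_distrib
      by (intro has_sum_cmult_right has_sum_infsum w2)
    show "(\<lambda>i. (norm (v i))\<^sup>2 * (\<Sum>\<^sub>\<infinity>j\<in>J. (norm (w j))\<^sup>2)) summable_on I"
      by (intro summable_on_cmult_left v2)
  qed simp
  then show sum: "(\<lambda>p. (norm (\<tau> (v (fst p)) (w (snd p))))\<^sup>2) summable_on I \<times> J"
    by (simp add: u_def)
  fix z z' assume "z \<in> {\<tau> x y | x y. True}" "z' \<in> {\<tau> x y | x y. True}"
  then obtain x y x' y' where z: "z = \<tau> x y" "z' = \<tau> x' y'" by auto
  define s where "s = (\<Sum>\<^sub>\<infinity>p\<in>I\<times>J. cinner z (u p) * cinner (u p) z')"
  have s: "((\<lambda>p. cinner z (u p) * cinner (u p) z') has_sum s) (I \<times> J)"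
    unfolding s_def u_def by (rule square_summable_form(1) [OF sum])
  have "((\<lambda>i. cinner x (v i) * cinner (v i) x' * cinner y (\<rho>' y')) has_sum s) I"
  proof (rule has_sum_SigmaD [OF s])
    fix i
    show "((\<lambda>j. cinner z (u (i, j)) * cinner (u (i, j)) z') has_sum
        cinner x (v i) * cinner (v i) x' * cinner y (\<rho>' y')) J"
      using has_sum_cmult_right [OF w1 [of y y'], of "cinner x (v i) * cinner (v i) x'"]
      by (simp add: u_def z cinner_tensor mult_ac)
  qed
  moreover have "((\<lambda>i. cinner x (v i) * cinner (v i) x' * cinner y (\<rho>' y')) has_sum
      cinner x (\<rho> x') * cinner y (\<rho>' y')) I"
    by (intro has_sum_cmult_left v1)
  ultimately have "s = cinner z (operator_tensor \<tau> \<rho> \<rho>' z')"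
    using has_sum_unique by (simp add: z operator_tensor lin cinner_tensor) blast
  then show "((\<lambda>p. cinner z (\<tau> (v (fst p)) (w (snd p))) * cinner (\<tau> (v (fst p)) (w (snd p))) z') has_sum
      cinner z (operator_tensor \<tau> \<rho> \<rho>' z')) (I \<times> J)"
    using s by (simp add: u_def)
qed

end

section \<open>Extreme eigenvalues\<close>

lemma independent_orthonormal_basis:
  assumes E: "orthonormal_basis E"
  shows "complex_vector.independent E"
  unfolding complex_vector.independent_explicit_finite_subsets
proof (intro allI impI ballI)
  fix F c f assume "F \<subseteq> E" "finite F" "(\<Sum>e\<in>F. c e *\<^sub>C e) = 0" "f \<in> F"
  then show "c f = 0"
    using orthonormal_coefficient [OF E, of F f c] by simp
qed

lemma finite_orthonormal_basis_expansion:
  assumes E: "orthonormal_basis E" and fin: "finite E"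
  shows "x = (\<Sum>e\<in>E. cinner e x *\<^sub>C e)"
proof -
  have "(\<Sum>e\<in>E. (cmod (cinner e x))\<^sup>2) = (norm x)\<^sup>2"
    using parseval [OF E, of x] fin by (simp add: has_sum_finite_iff)
  then have "(norm (x - (\<Sum>e\<in>E. cinner e x *\<^sub>C e)))\<^sup>2 = 0"
    by (simp add: norm_diff_orthonormal_sum [OF E fin])
  then show ?thesis by simp
qed

lemma span_finite_orthonormal_basis:
  assumes E: "orthonormal_basis E" and fin: "finite E"
  shows "complex_vector.span E = UNIV"
proof -
  have "x \<in> complex_vector.span E" for x
    by (subst finite_orthonormal_basis_expansion [OF assms])
      (intro complex_vector.span_sum complex_vector.span_scale complex_vector.span_base)
  then show ?thesis by auto
qed

text \<open>\<open>smallest_eigenvalue\<close> branches on a finite spanning set, the computations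
  on a basis. Orthonormality gives independence, hence a basis is no larger than a finite spanning
  set.\<close>

lemma finite_dimensional_iff_finite:
  assumes E: "orthonormal_basis (E :: 'a::complex_inner set)"
  shows "finite_dimensional TYPE('a) \<longleftrightarrow> finite E"
proof
  assume "finite_dimensional TYPE('a)"
  then obtain B :: "'a set" where "finite B" "complex_vector.span B = UNIV"
    by (auto simp: finite_dimensional_def)
  then show "finite E"
    using complex_vector.independent_span_bound [OF _ independent_orthonormal_basis [OF E]] by blast
next
  assume "finite E"
  then show "finite_dimensional TYPE('a)"
    using span_finite_orthonormal_basis [OF E] by (auto simp: finite_dimensional_def)
qed

text \<open>In finite dimension injectivity gives surjectivity, and the inverse is bounded by its
  values on a basis; the 1 added in the bound keeps \<open>K\<close> positive.\<close>

lemma injective_left_inverse: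
  fixes T :: "'a::complex_inner \<Rightarrow> 'a"
  assumes E: "orthonormal_basis (E :: 'a set)" and fin: "finite E"
    and T: "bounded_clinear T" and inj: "\<And>x. T x = 0 \<Longrightarrow> x = 0"
  obtains S K where "\<And>x. S (T x) = x" "\<And>x. norm (S x) \<le> norm x * K" "K > 0"
proof -
  interpret finite_dimensional_vector_space "scaleC :: complex \<Rightarrow> 'a \<Rightarrow> 'a" E
    by unfold_locales
      (simp_all add: fin independent_orthonormal_basis E span_finite_orthonormal_basis)
  note lin = bounded_clinearD [OF T]
  have injT: "inj T"
    using inj lin(3) by (metis injI eq_iff_diff_eq_0)
  moreover have "Vector_Spaces.linear (scaleC :: complex \<Rightarrow> 'a \<Rightarrow> 'a) scaleC T"
    unfolding Vector_Spaces.linear_iff using lin by (simp add: complex_vector.vector_space_axioms)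
  ultimately have "surj T"
    using linear_inj_imp_surj by blast
  define S where "S = inv T"
  have TS: "T (S y) = y" for y
    unfolding S_def using \<open>surj T\<close> by (rule surj_f_inv_f)
  have ST: "S (T x) = x" for x
    unfolding S_def using injT by (rule inv_f_f)
  have add: "S (x + y) = S x + S y" and scale: "S (c *\<^sub>C x) = c *\<^sub>C S x" for x y c
    by (metis ST TS lin(2), metis ST TS lin(5))
  have sum: "S (\<Sum>i\<in>I. f i) = (\<Sum>i\<in>I. S (f i))" if "finite I" for I and f :: "'a \<Rightarrow> 'a"
    using that by (induction I) (auto simp: add, metis ST lin(4))
  have "norm (S x) \<le> norm x * ((\<Sum>e\<in>E. norm (S e)) + 1)" for x
  proof -
    have "norm (S x) = norm (\<Sum>e\<in>E. cinner e x *\<^sub>C S e)"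
      by (subst finite_orthonormal_basis_expansion [OF E fin, of x]) (simp add: sum fin scale)
    also have "\<dots> \<le> (\<Sum>e\<in>E. norm (cinner e x *\<^sub>C S e))"
      by (rule norm_sum)
    also have "\<dots> \<le> (\<Sum>e\<in>E. norm x * norm (S e))"
    proof (rule sum_mono)
      fix e assume "e \<in> E"
      then have "cmod (cinner e x) \<le> norm x"
        using norm_cinner_le [of e x] norm_orthonormal_basis [OF E, of e] by simp
      then show "norm (cinner e x *\<^sub>C S e) \<le> norm x * norm (S e)"
        by (simp add: norm_scaleC mult_right_mono)
    qed
    also have "\<dots> \<le> norm x * ((\<Sum>e\<in>E. norm (S e)) + 1)"
      by (simp add: algebra_simps flip: sum_distrib_left)
    finally show ?thesis .
  qed
  moreover have "0 < (\<Sum>e\<in>E. norm (S e)) + 1"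
    by (intro add_nonneg_pos sum_nonneg) auto
  ultimately show thesis
    by (rule that [OF ST])
qed

text \<open>Cauchy-Schwarz for the form at \<open>T x\<close> and \<open>x\<close> bounds
  \<open>(norm (T x))\<^sup>2\<close> by \<open>Re (cinner x (T x)) * L\<close>, and the left
  inverse bounds \<open>norm x\<close> by \<open>norm (T x) * K\<close>; hence the constant
  \<open>1 / (K\<^sup>2 * L)\<close>. It serves twice: to attain the lowest eigenvalue, and to place
  0 in the spectrum in infinite dimension.\<close>

lemma positive_semidefinite_bounded_below:
  assumes T: "positive_semidefinite T"
    and S: "\<And>x. S (T x) = x" "\<And>x. norm (S x) \<le> norm x * K" "K > 0"
  obtains c where "c > 0" "\<And>x. c * (norm x)\<^sup>2 \<le> Re (cinner x (T x))"
proof -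
  obtain L where L: "L > 0" "\<And>x. norm (T x) \<le> norm x * L"
    using bounded_clinear_bound positive_semidefiniteD(2) [OF T] by blast
  have T2: "(norm (T x))\<^sup>2 \<le> Re (cinner x (T x)) * L" for x
  proof (cases "T x = 0")
    case False
    have "((norm (T x))\<^sup>2)\<^sup>2 = (cmod (cinner (T x) (T x)))\<^sup>2"
      by (simp add: cinner_self norm_power)
    also have "\<dots> \<le> Re (cinner (T x) (T (T x))) * Re (cinner x (T x))"
      by (rule positive_semidefinite_cauchy_schwarz [OF T])
    also have "\<dots> \<le> (norm (T x) * (norm (T x) * L)) * Re (cinner x (T x))"
    proof (rule mult_right_mono [OF _ positive_semidefiniteD(3) [OF T]])
      have "Re (cinner (T x) (T (T x))) \<le> norm (T x) * norm (T (T x))"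
        by (rule order_trans [OF complex_Re_le_cmod norm_cinner_le])
      also have "\<dots> \<le> norm (T x) * (norm (T x) * L)"
        by (intro mult_left_mono L) auto
      finally show "Re (cinner (T x) (T (T x))) \<le> \<dots>" .
    qed
    finally have "(norm (T x))\<^sup>2 * (norm (T x))\<^sup>2 \<le> (norm (T x))\<^sup>2 * (Re (cinner x (T x)) * L)"
      by (simp add: power2_eq_square mult_ac)
    then show ?thesis
      using False mult_left_le_imp_le zero_less_norm_iff zero_less_power by blast
  qed (use positive_semidefiniteD(3) [OF T, of x] in simp)
  show thesis
  proof
    show "1 / (K\<^sup>2 * L) > 0"
      using L S by simp
    fix x
    have "(norm x)\<^sup>2 \<le> (norm (T x) * K)\<^sup>2"
      using S(2) [of "T x"] by (simp add: S(1) power_mono)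
    also have "\<dots> \<le> (Re (cinner x (T x)) * L) * K\<^sup>2"
      unfolding power_mult_distrib by (intro mult_right_mono T2) auto
    finally show "1 / (K\<^sup>2 * L) * (norm x)\<^sup>2 \<le> Re (cinner x (T x))"
      using L S by (simp add: divide_le_eq mult_ac)
  qed
qed

lemma hermitian_shift:
  assumes "hermitian H"
  shows "hermitian (\<lambda>x. H x - complex_of_real l *\<^sub>C x)"
    and "Re (cinner x (H x - complex_of_real l *\<^sub>C x)) = Re (cinner x (H x)) - l * (norm x)\<^sup>2"
proof -
  have "bounded_clinear (\<lambda>x :: 'a. complex_of_real l *\<^sub>C x)"
    using bounded_clinear_scaleC [OF bounded_clinear_id] by simp
  then show "hermitian (\<lambda>x. H x - complex_of_real l *\<^sub>C x)"
    using assms bounded_clinear_diff by (auto simp: hermitian_def cinner_simps)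
  show "Re (cinner x (H x - complex_of_real l *\<^sub>C x)) = Re (cinner x (H x)) - l * (norm x)\<^sup>2"
    by (simp add: cinner_simps cinner_self)
qed

text \<open>The infimum \<open>l\<close> of the form on the unit sphere must be an eigenvalue:
  otherwise \<open>H\<close> shifted by \<open>l\<close> is injective, hence bounded below by some
  \<open>c > 0\<close>, and the infimum would be at least \<open>l + c\<close>. This replaces
  compactness of the sphere.\<close>

lemma lowest_eigenvalue_exists:
  fixes H :: "'a::complex_inner \<Rightarrow> 'a"
  assumes H: "hermitian H" and E: "orthonormal_basis (E :: 'a set)" "finite E" "E \<noteq> {}"
  obtains l where "eigenvalue H (complex_of_real l)"
    "\<And>x. l * (norm x)\<^sup>2 \<le> Re (cinner x (H x))"
proof -
  obtain K where K: "K > 0" "\<And>x. norm (H x) \<le> norm x * K"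
    using bounded_clinear_bound hermitianD(1) [OF H] by blast
  define q where "q x = Re (cinner x (H x))" for x
  define l where "l = Inf (q ` {x. norm x = 1})"
  have ne: "q ` {x. norm x = 1} \<noteq> {}"
    using E(3) norm_orthonormal_basis [OF E(1)] by auto
  have "- K \<le> q x" if "norm x = 1" for x
  proof -
    have "\<bar>q x\<bar> \<le> norm x * norm (H x)"
      unfolding q_def by (rule order_trans [OF abs_Re_le_cmod norm_cinner_le])
    then show ?thesis using K(2) [of x] that by simp
  qed
  then have bdd: "bdd_below (q ` {x. norm x = 1})"
    by (intro bdd_belowI2) auto
  have q_scale: "(norm x)\<^sup>2 * q (sgn x) = q x" for x
    by (simp add: q_def sgn_div_norm cinner_simps bounded_clinearD [OF hermitianD(1) [OF H]]
        power2_eq_square)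
  have bound: "l * (norm x)\<^sup>2 \<le> q x" for x
  proof (cases "x = 0")
    case False
    then have "l \<le> q (sgn x)"
      unfolding l_def by (intro cInf_lower bdd) (auto simp: norm_sgn)
    then show ?thesis
      using mult_left_mono [of l "q (sgn x)" "(norm x)\<^sup>2"] q_scale [of x] by (simp add: mult.commute)
  qed (simp add: q_def)
  define T where "T x = H x - complex_of_real l *\<^sub>C x" for x
  have T: "positive_semidefinite T"
    using hermitian_shift [OF H] bound by (simp add: positive_semidefinite_def T_def [abs_def] q_def)
  have "eigenvalue H (complex_of_real l)"
  proof (rule ccontr)
    assume "\<not> eigenvalue H (complex_of_real l)"
    then have inj: "\<And>x. T x = 0 \<Longrightarrow> x = 0"
      by (auto simp: eigenvalue_def T_def)
    obtain S K where S: "\<And>x. S (T x) = x" "\<And>x. norm (S x) \<le> norm x * K" "K > 0"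
      using injective_left_inverse [OF E(1,2) positive_semidefiniteD(2) [OF T] inj] by blast
    obtain c where c: "c > 0" "\<And>x. c * (norm x)\<^sup>2 \<le> Re (cinner x (T x))"
      using positive_semidefinite_bounded_below [OF T S] by blast
    have "l + c \<le> q x" if "norm x = 1" for x
      using c(2) [of x] that by (simp add: T_def hermitian_shift(2) [OF H] q_def)
    then have "l + c \<le> l"
      unfolding l_def using ne by (intro cInf_greatest) (auto simp flip: l_def)
    with \<open>c > 0\<close> show False by simp
  qed
  with bound that show thesis by (simp add: q_def)
qed

lemma eigenvalue_quadratic_form:
  assumes "eigenvalue T (complex_of_real l)"
  obtains x where "x \<noteq> 0" "Re (cinner x (T x)) = l * (norm x)\<^sup>2"
  using assms by (auto simp: eigenvalue_def cinner_simps cinner_self)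

lemma finite_dimensional_extreme_eigenvalues:
  fixes T :: "'a::complex_inner \<Rightarrow> 'a"
  assumes T: "positive_semidefinite T" and E: "orthonormal_basis (E :: 'a set)" "finite E" "E \<noteq> {}"
  shows "smallest_eigenvalue T * (norm x)\<^sup>2 \<le> Re (cinner x (T x))"
    and "Re (cinner x (T x)) \<le> largest_eigenvalue T * (norm x)\<^sup>2"
    and "0 \<le> smallest_eigenvalue T"
proof -
  have le: "l \<le> m" if "l * (norm x)\<^sup>2 \<le> m * (norm x)\<^sup>2" "x \<noteq> 0" for l m :: real and x :: 'a
    using that by (simp add: mult_le_cancel_right)
  have H: "hermitian T" "hermitian (\<lambda>x. - T x)"
    using positive_semidefiniteD [OF T] bounded_clinear_scaleC [OF positive_semidefiniteD(2) [OF T], of "-1"]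
    by (auto simp: hermitian_def cinner_simps)
  obtain l where l: "eigenvalue T (complex_of_real l)" "\<And>x. l * (norm x)\<^sup>2 \<le> Re (cinner x (T x))"
    using lowest_eigenvalue_exists [OF H(1) E] by blast
  obtain m where m: "eigenvalue (\<lambda>x. - T x) (complex_of_real m)"
    "\<And>x. m * (norm x)\<^sup>2 \<le> Re (cinner x (- T x))"
    using lowest_eigenvalue_exists [OF H(2) E] by blast
  have "(LEAST l. eigenvalue T (complex_of_real l)) = l"
  proof (rule Least_equality)
    fix k assume "eigenvalue T (complex_of_real k)"
    then obtain x where "x \<noteq> 0" "Re (cinner x (T x)) = k * (norm x)\<^sup>2"
      by (rule eigenvalue_quadratic_form)
    then show "l \<le> k" using l(2) [of x] le [of l x k] by simp
  qed (rule l)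
  then have small: "smallest_eigenvalue T = l"
    by (simp add: smallest_eigenvalue_def finite_dimensional_iff_finite [OF E(1)] E)
  have large: "largest_eigenvalue T = - m"
    unfolding largest_eigenvalue_def
  proof (rule Greatest_equality)
    obtain y where "y \<noteq> 0" and y: "- T y = complex_of_real m *\<^sub>C y"
      using m(1) by (auto simp: eigenvalue_def)
    have "T y = complex_of_real (- m) *\<^sub>C y"
      using arg_cong [OF y, of uminus] by simp
    with \<open>y \<noteq> 0\<close> show "eigenvalue T (complex_of_real (- m))"
      unfolding eigenvalue_def by blast
    fix k assume "eigenvalue T (complex_of_real k)"
    then obtain x where "x \<noteq> 0" "Re (cinner x (T x)) = k * (norm x)\<^sup>2"
      by (rule eigenvalue_quadratic_form)
    then show "k \<le> - m" using m(2) [of x] le [of k x "- m"] by (simp add: cinner_simps)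
  qed
  show "smallest_eigenvalue T * (norm x)\<^sup>2 \<le> Re (cinner x (T x))"
    unfolding small by (rule l)
  show "Re (cinner x (T x)) \<le> largest_eigenvalue T * (norm x)\<^sup>2"
    unfolding large using m(2) [of x] by (simp add: cinner_simps)
  obtain y where "y \<noteq> 0" "Re (cinner y (T y)) = l * (norm y)\<^sup>2"
    using l(1) by (rule eigenvalue_quadratic_form)
  then show "0 \<le> smallest_eigenvalue T"
    unfolding small using positive_semidefiniteD(3) [OF T, of y] le [of 0 y l] by simp
qed

text \<open>Lax-Milgram by Banach's fixed point theorem: solutions of \<open>T x = y\<close> are the
  fixed points of \<open>x - t *\<^sub>R (T x - y)\<close>, a contraction for suitable
  \<open>t\<close>.\<close>

lemma coercive_invertible:
  fixes T :: "'a::hilbert_space \<Rightarrow> 'a"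
  assumes T: "bounded_clinear T" and c: "c > 0" "\<And>x. c * (norm x)\<^sup>2 \<le> Re (cinner x (T x))"
  obtains S where "bounded_clinear S" "T \<circ> S = id" "S \<circ> T = id"
proof -
  note lin = bounded_clinearD [OF T]
  obtain K' where K': "K' > 0" "\<And>x. norm (T x) \<le> norm x * K'"
    using bounded_clinear_bound T by blast
  \<comment> \<open>\<open>c \<le> K\<close> makes \<open>c\<^sup>2 / K\<^sup>2\<close> at most 1,
    so that \<open>r\<close> below is the root of a nonnegative number.\<close>
  define K where "K = max K' c"
  have K: "norm (T x) \<le> norm x * K" "K > 0" "c \<le> K" for x
    using order_trans [OF K'(2) [of x] mult_left_mono [of K' K "norm x"]] c by (auto simp: K_def)
  have lower: "c * norm x \<le> norm (T x)" for x
  proof (cases "x = 0")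
    case False
    have "c * (norm x)\<^sup>2 \<le> norm x * norm (T x)"
      by (rule order_trans [OF c(2) order_trans [OF complex_Re_le_cmod norm_cinner_le]])
    then show ?thesis using False by (simp add: power2_eq_square mult_ac)
  qed simp
  \<comment> \<open>The minimiser of 1 - 2 t c + t^2 K^2; the minimum is the square of
    \<open>r\<close>.\<close>
  define t where "t = c / K\<^sup>2"
  define r where "r = sqrt (1 - c\<^sup>2 / K\<^sup>2)"
  have "c\<^sup>2 \<le> K\<^sup>2" using c K by (simp add: power_mono)
  then have r: "0 \<le> r" "r < 1" "r\<^sup>2 = 1 - c\<^sup>2 / K\<^sup>2"
    using c K by (auto simp: r_def)
  have contraction: "norm (w - t *\<^sub>R T w) \<le> r * norm w" for w
  proof -
    have "(norm (w - t *\<^sub>R T w))\<^sup>2 = (norm w)\<^sup>2 - 2 * t * Re (cinner w (T w)) + t\<^sup>2 * (norm (T w))\<^sup>2"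
      unfolding power2_norm_eq_inner inner_eq_Re_cinner [symmetric]
      by (simp add: inner_diff_left inner_diff_right inner_commute [of "T w" w] power2_eq_square
          right_diff_distrib mult.assoc)
    also have "\<dots> \<le> (norm w)\<^sup>2 - 2 * t * (c * (norm w)\<^sup>2) + t\<^sup>2 * (norm w * K)\<^sup>2"
      using c K by (intro add_mono diff_mono mult_left_mono power_mono order_refl) (auto simp: t_def)
    also have "\<dots> = r\<^sup>2 * (norm w)\<^sup>2"
      unfolding r(3) t_def using K by (simp add: field_simps power2_eq_square)
    finally have "(norm (w - t *\<^sub>R T w))\<^sup>2 \<le> (r * norm w)\<^sup>2"
      by (simp add: power_mult_distrib)
    then show ?thesis
      by (rule power2_le_imp_le) (use r in simp)
  qed
  have "\<exists>x. T x = y" for y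
  proof -
    have "\<exists>!x. x - t *\<^sub>R (T x - y) = x"
    proof (rule banach_fix_type [OF r(1,2)], intro allI)
      fix x x'
      have eq: "x - t *\<^sub>R (T x - y) - (x' - t *\<^sub>R (T x' - y)) = (x - x') - t *\<^sub>R T (x - x')"
        by (simp add: lin algebra_simps)
      show "dist (x - t *\<^sub>R (T x - y)) (x' - t *\<^sub>R (T x' - y)) \<le> r * dist x x'"
        unfolding dist_norm eq by (rule contraction)
    qed
    then obtain x where "x - t *\<^sub>R (T x - y) = x" by blast
    then have "T x = y" using c K by (auto simp: t_def)
    then show ?thesis ..
  qed
  then obtain S where TS: "\<And>y. T (S y) = y" by metis
  have inj: "x = y" if "T x = T y" for x y
    using lower [of "x - y"] that c by (simp add: lin)
      (metis mult_less_cancel_left_pos mult_zero_right not_le norm_le_zero_iff right_minus_eq)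
  have "bounded_clinear S"
  proof (rule bounded_clinearI [where K = "1 / c"])
    show "norm (S x) \<le> norm x * (1 / c)" for x
      using lower [of "S x"] c by (simp add: TS field_simps)
  qed (rule inj, simp add: TS lin)+
  moreover have "S (T x) = x" for x
    by (rule inj) (simp add: TS)
  ultimately show thesis
    using TS that by (auto simp: fun_eq_iff)
qed

text \<open>If 0 were outside the spectrum, the form would be bounded below by some
  \<open>c > 0\<close>, and enough basis vectors would together exceed the trace. A negative
  \<open>l\<close> lies outside because \<open>T\<close> shifted by \<open>l\<close> is coercive
  with constant \<open>- l\<close>. So the infimum is attained at 0.\<close>

lemma infinite_dimensional_smallest_eigenvalue:
  fixes T :: "'a::hilbert_space \<Rightarrow> 'a"
  assumes T: "positive_semidefinite T" and E: "orthonormal_basis (E :: 'a set)" "infinite E"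
    and tr: "(\<lambda>e. Re (cinner e (T e))) summable_on E"
  shows "smallest_eigenvalue T = 0"
proof -
  have "0 \<in> spectrum T"
  proof (rule ccontr)
    assume "0 \<notin> spectrum T"
    then obtain S where S: "bounded_clinear S" "S \<circ> T = id"
      by (auto simp: spectrum_def)
    obtain K where K: "K > 0" "\<And>x. norm (S x) \<le> norm x * K"
      using bounded_clinear_bound S(1) by blast
    have ST: "S (T x) = x" for x
      using S(2) by (simp add: fun_eq_iff)
    obtain c where c: "c > 0" "\<And>x. c * (norm x)\<^sup>2 \<le> Re (cinner x (T x))"
      using positive_semidefinite_bounded_below [OF T ST K(2,1)] by blast
    obtain n :: nat where n: "(\<Sum>\<^sub>\<infinity>e\<in>E. Re (cinner e (T e))) < real n * c"
      using c(1) reals_Archimedean3 by blast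
    obtain F where F: "finite F" "card F = n" "F \<subseteq> E"
      using E(2) infinite_arbitrarily_large by blast
    have "real n * c = (\<Sum>e\<in>F. c)"
      by (simp add: F)
    also have "\<dots> \<le> (\<Sum>e\<in>F. Re (cinner e (T e)))"
    proof (rule sum_mono)
      fix e assume "e \<in> F"
      then show "c \<le> Re (cinner e (T e))"
        using c(2) [of e] norm_orthonormal_basis [OF E(1), of e] F by auto
    qed
    also have "\<dots> \<le> (\<Sum>\<^sub>\<infinity>e\<in>E. Re (cinner e (T e)))"
      using F positive_semidefiniteD(3) [OF T] by (intro finite_sum_le_infsum tr) auto
    finally show False using n by simp
  qed
  moreover have "0 \<le> l" if "complex_of_real l \<in> spectrum T" for l
  proof (rule ccontr)
    assume "\<not> 0 \<le> l"
    then have 0: "- l > 0" by simp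
    have 1: "- l * (norm x)\<^sup>2 \<le> Re (cinner x (T x - complex_of_real l *\<^sub>C x))" for x
      using positive_semidefiniteD(3) [OF T, of x]
      by (simp add: hermitian_shift(2) positive_semidefiniteD(1) [OF T])
    have 2: "bounded_clinear (\<lambda>x. T x - complex_of_real l *\<^sub>C x)"
      by (intro hermitianD hermitian_shift positive_semidefiniteD [OF T])
    obtain S where "bounded_clinear S" "(\<lambda>x. T x - complex_of_real l *\<^sub>C x) \<circ> S = id"
      "S \<circ> (\<lambda>x. T x - complex_of_real l *\<^sub>C x) = id"
      by (rule coercive_invertible [OF 2 0 1])
    with that show False by (auto simp: spectrum_def)
  qed
  ultimately have "Inf {l. complex_of_real l \<in> spectrum T} = 0"
    by (intro cInf_eq_minimum) auto
  then show ?thesis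
    using E by (simp add: smallest_eigenvalue_def finite_dimensional_iff_finite)
qed

section \<open>The uncertainty relation\<close>

lemma dyadic_has_sum_norm:
  assumes "dyadic \<sigma> I v" "bounded_clinear Z"
  shows "((\<lambda>i. (norm (Z (v i)))\<^sup>2) has_sum (\<Sum>\<^sub>\<infinity>i\<in>I. (norm (Z (v i)))\<^sup>2)) I"
  using summable_on_Re [OF dyadic_summable [OF assms(1,2,2)]] by (simp add: Re_cinner_self)

lemma dyadic_has_sum_form:
  assumes "dyadic \<sigma> I v"
  shows "((\<lambda>i. (cmod (cinner x (v i)))\<^sup>2) has_sum Re (cinner x (\<sigma> x))) I"
proof -
  have "((\<lambda>i. Re (cinner x (v i) * cinner (v i) x)) has_sum Re (cinner x (\<sigma> x))) I"
    using assms by (intro has_sum_Re) (simp add: dyadic_def)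
  then show ?thesis by (simp add: cinner_mult_commuted)
qed

text \<open>The hypothesis on \<open>Z\<close> is applied to \<open>Z = s N + \<i> L\<close> for all real \<open>s\<close>.\<close>

lemma weighted_uncertainty:
  fixes N L :: "'a::hilbert_space \<Rightarrow> 'a"
  assumes \<sigma>: "dyadic \<sigma> I v" and N: "hermitian N" and L: "hermitian L"
    and m: "0 \<le> m" "m < M"
    and Z: "\<And>Z. bounded_clinear Z \<Longrightarrow>
      m * (\<Sum>\<^sub>\<infinity>i\<in>I. (norm (Z (v i)))\<^sup>2) \<le> M * (\<Sum>\<^sub>\<infinity>i\<in>I. (norm (cadjoint Z (v i)))\<^sup>2)"
  shows "(M + m) * cmod (\<Sum>\<^sub>\<infinity>i\<in>I. cinner (v i) (N (L (v i)) - L (N (v i)))) \<le>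
    2 * (M - m) * (sqrt (\<Sum>\<^sub>\<infinity>i\<in>I. (norm (N (v i)))\<^sup>2) * sqrt (\<Sum>\<^sub>\<infinity>i\<in>I. (norm (L (v i)))\<^sup>2))"
proof -
  define a where "a = (\<Sum>\<^sub>\<infinity>i\<in>I. (norm (N (v i)))\<^sup>2)"
  define b where "b = (\<Sum>\<^sub>\<infinity>i\<in>I. (norm (L (v i)))\<^sup>2)"
  \<comment> \<open>Up to the factor 2 \<i> this is the expectation of the commutator.\<close>
  define g where "g = Im (\<Sum>\<^sub>\<infinity>i\<in>I. cinner (N (v i)) (L (v i)))"
  note bN = hermitianD(1) [OF N] and bL = hermitianD(1) [OF L]
  have a: "((\<lambda>i. (norm (N (v i)))\<^sup>2) has_sum a) I"
    unfolding a_def by (rule dyadic_has_sum_norm [OF \<sigma> bN])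
  have b: "((\<lambda>i. (norm (L (v i)))\<^sup>2) has_sum b) I"
    unfolding b_def by (rule dyadic_has_sum_norm [OF \<sigma> bL])
  have g: "((\<lambda>i. Im (cinner (N (v i)) (L (v i)))) has_sum g) I"
    unfolding g_def by (intro has_sum_Im has_sum_infsum dyadic_summable [OF \<sigma> bN bL])
  have norm2: "(norm (complex_of_real s *\<^sub>C N x + (of_real t * \<i>) *\<^sub>C L x))\<^sup>2 =
      s\<^sup>2 * (norm (N x))\<^sup>2 + t\<^sup>2 * (norm (L x))\<^sup>2 - 2 * s * t * Im (cinner (N x) (L x))" for s t x
  proof -
    have "cinner (L x) (N x) = cnj (cinner (N x) (L x))"
      by (rule cinner_commute)
    then show ?thesis
      unfolding Re_cinner_self [symmetric]
      by (simp add: cinner_simps) (simp add: cinner_self algebra_simps power2_eq_square)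
  qed
  have sum: "((\<lambda>i. (norm (complex_of_real s *\<^sub>C N (v i) + (of_real t * \<i>) *\<^sub>C L (v i)))\<^sup>2)
      has_sum s\<^sup>2 * a + t\<^sup>2 * b - 2 * s * t * g) I" for s t
    unfolding norm2 by (intro has_sum_add has_sum_diff has_sum_cmult_right a b g)
  have "0 \<le> ((M - m) * a) * s\<^sup>2 - 2 * ((M + m) * (- g)) * s + (M - m) * b" for s
  proof -
    define Z where "Z x = complex_of_real s *\<^sub>C N x + (of_real 1 * \<i>) *\<^sub>C L x" for x
    have bZ: "bounded_clinear Z"
      unfolding Z_def [abs_def] by (intro bounded_clinear_add bounded_clinear_scaleC bN bL)
    \<comment> \<open>The adjoint only flips the sign of the imaginary part, so \<open>sum\<close>
      with \<open>t = 1\<close> and \<open>t = - 1\<close> gives the two sides of the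
      hypothesis.\<close>
    have "cadjoint Z = (\<lambda>x. complex_of_real s *\<^sub>C N x + (of_real (- 1) * \<i>) *\<^sub>C L x)"
      by (rule cadjoint_eqI) (simp add: Z_def cinner_simps hermitianD(2) [OF N] hermitianD(2) [OF L])
    then have "m * (s\<^sup>2 * a + 1\<^sup>2 * b - 2 * s * 1 * g) \<le> M * (s\<^sup>2 * a + (-1)\<^sup>2 * b - 2 * s * (-1) * g)"
      using Z [OF bZ] infsumI [OF sum [of s 1]] infsumI [OF sum [of s "- 1"]] by (simp add: Z_def)
    then show ?thesis by (simp add: algebra_simps)
  qed
  moreover have "0 \<le> a" "0 \<le> b"
    by (simp_all add: a_def b_def infsum_nonneg)
  ultimately have "((M + m) * (- g))\<^sup>2 \<le> ((M - m) * a) * ((M - m) * b)"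
    using m by (intro real_discriminant) auto
  then have "((M + m) * \<bar>g\<bar>)\<^sup>2 \<le> ((M - m) * (sqrt a * sqrt b))\<^sup>2"
    using \<open>0 \<le> a\<close> \<open>0 \<le> b\<close> by (simp add: power_mult_distrib) (simp add: power2_eq_square mult_ac)
  then have le: "(M + m) * \<bar>g\<bar> \<le> (M - m) * (sqrt a * sqrt b)"
    by (rule power2_le_imp_le) (use m \<open>0 \<le> a\<close> \<open>0 \<le> b\<close> in simp)
  have "cinner x (N (L x) - L (N x)) = of_real (2 * Im (cinner (N x) (L x))) * \<i>" for x
    using cinner_commute [of "L x" "N x"]
    by (simp add: cinner_simps complex_eq_iff
        hermitianD(2) [OF N, symmetric] hermitianD(2) [OF L, symmetric])
  then have "((\<lambda>i. cinner (v i) (N (L (v i)) - L (N (v i)))) has_sum of_real (2 * g) * \<i>) I"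
    by (simp only:) (intro has_sum_cmult_left has_sum_of_real has_sum_cmult_right g)
  then have "cmod (\<Sum>\<^sub>\<infinity>i\<in>I. cinner (v i) (N (L (v i)) - L (N (v i)))) = 2 * \<bar>g\<bar>"
    by (simp add: infsumI norm_mult)
  then show ?thesis
    unfolding a_def [symmetric] b_def [symmetric]
    using mult_left_mono [OF le, of 2] by (simp add: algebra_simps)
qed

text \<open>The unweighted sum over \<open>G\<close> in the middle is the squared Hilbert-Schmidt
  norm, which is the same for \<open>Z\<close> and its adjoint because their matrices have the same
  moduli up to transposition. Finiteness of \<open>G\<close> makes it available for every bounded
  \<open>Z\<close>.\<close>

lemma finite_dimensional_trace_bound:
  fixes Z :: "'a::hilbert_space \<Rightarrow> 'a"
  assumes \<sigma>: "dyadic \<sigma> I v" and G: "orthonormal_basis (G :: 'a set)" "finite G"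
    and m: "\<And>x. m * (norm x)\<^sup>2 \<le> Re (cinner x (\<sigma> x))" "0 \<le> m"
    and M: "\<And>x. Re (cinner x (\<sigma> x)) \<le> M * (norm x)\<^sup>2" "0 \<le> M"
    and Z: "bounded_clinear Z"
  shows "m * (\<Sum>\<^sub>\<infinity>i\<in>I. (norm (Z (v i)))\<^sup>2) \<le> M * (\<Sum>\<^sub>\<infinity>i\<in>I. (norm (cadjoint Z (v i)))\<^sup>2)"
proof -
  have trace: "(\<Sum>\<^sub>\<infinity>i\<in>I. (norm (cadjoint T (v i)))\<^sup>2) = (\<Sum>g\<in>G. Re (cinner (T g) (\<sigma> (T g))))"
    if T: "bounded_clinear T" for T
  proof -
    have "((\<lambda>i. Re (cinner (cadjoint T (v i)) (cadjoint T (v i)))) has_sum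
        Re (\<Sum>g\<in>G. cinner (T g) (\<sigma> (T g)))) I"
      using dyadic_trace [OF \<sigma> G(1) T T] G(2) by (intro has_sum_Re) (simp add: has_sum_finite_iff)
    then show ?thesis
      by (simp add: Re_cinner_self infsumI)
  qed
  have norm2: "(norm x)\<^sup>2 = (\<Sum>g\<in>G. (cmod (cinner g x))\<^sup>2)" for x
    using parseval [OF G(1), of x] G(2) by (simp add: has_sum_finite_iff)
  have swap: "(\<Sum>g\<in>G. (norm (cadjoint Z g))\<^sup>2) = (\<Sum>g\<in>G. (norm (Z g))\<^sup>2)"
  proof -
    have eq: "cmod (cinner h (cadjoint Z g)) = cmod (cinner g (Z h))" for g h
      by (metis cinner_cadjoint_left [OF Z] cinner_commute complex_mod_cnj)
    show ?thesis
      unfolding norm2 eq by (rule sum.swap)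
  qed
  have adj: "cadjoint (cadjoint Z) = Z"
    by (rule cadjoint_eqI) (simp add: cinner_cadjoint_right Z)
  have "(\<Sum>\<^sub>\<infinity>i\<in>I. (norm (Z (v i)))\<^sup>2) \<le> (\<Sum>g\<in>G. M * (norm (cadjoint Z g))\<^sup>2)"
    using trace [OF bounded_clinear_cadjoint [OF Z]] by (simp add: adj M sum_mono)
  then have "m * (\<Sum>\<^sub>\<infinity>i\<in>I. (norm (Z (v i)))\<^sup>2) \<le> m * (M * (\<Sum>g\<in>G. (norm (Z g))\<^sup>2))"
    using m(2) by (intro mult_left_mono) (simp_all add: swap flip: sum_distrib_left)
  also have "\<dots> = M * (\<Sum>g\<in>G. m * (norm (Z g))\<^sup>2)"
    by (simp add: sum_distrib_left mult_ac)
  also have "\<dots> \<le> M * (\<Sum>g\<in>G. Re (cinner (Z g) (\<sigma> (Z g))))"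
    by (intro mult_left_mono sum_mono m M)
  finally show ?thesis
    by (simp add: trace [OF Z])
qed

context tensor_basis
begin

text \<open>The bounds of the two factors are applied one after the other, without product
  eigenvectors. Slicing \<open>z\<close> by the \<open>w j\<close> turns the form into the sum of
  \<open>Re (cinner (c j) (\<rho> (c j)))\<close>. Once \<open>\<rho>\<close> is bounded, the
  remaining sum of \<open>(norm (c j))\<^sup>2\<close> is the form of the identity tensored with
  \<open>\<rho>'\<close>, which slices along \<open>E\<close> express through \<open>\<rho>'\<close>
  alone.\<close>

lemma operator_tensor_form_bounds:
  assumes v: "dyadic \<rho> I v" and w: "dyadic \<rho>' J w"
    and lin: "bounded_clinear \<rho>" "bounded_clinear \<rho>'" and fin: "finite E"
    and l: "\<And>x. l * (norm x)\<^sup>2 \<le> Re (cinner x (\<rho> x))" "\<And>x. Re (cinner x (\<rho> x)) \<le> l' * (norm x)\<^sup>2"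
      "0 \<le> l" "0 \<le> l'"
    and k: "\<And>y. k * (norm y)\<^sup>2 \<le> Re (cinner y (\<rho>' y))" "\<And>y. Re (cinner y (\<rho>' y)) \<le> k' * (norm y)\<^sup>2"
  shows "l * k * (norm z)\<^sup>2 \<le> Re (cinner z (operator_tensor \<tau> \<rho> \<rho>' z))"
    and "Re (cinner z (operator_tensor \<tau> \<rho> \<rho>' z)) \<le> l' * k' * (norm z)\<^sup>2"
proof -
  interpret flip: tensor_basis "\<lambda>y x. \<tau> x y" F E
    by (rule flip)
  define c where "c j = contract (w j) z" for j
  define p where "p e = flip.contract e z" for e
  define s where "s = Re (cinner z (operator_tensor \<tau> \<rho> \<rho>' z))"
  define n where "n = (\<Sum>e\<in>E. Re (cinner (p e) (\<rho>' (p e))))"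
  have "((\<lambda>(i, j). (cmod (cinner z (\<tau> (v i) (w j))))\<^sup>2) has_sum s) (I \<times> J)"
    using dyadic_has_sum_form [OF dyadic_operator_tensor [OF v w lin], of z]
    by (simp add: s_def case_prod_unfold)
  then have "((\<lambda>(j, i). (cmod (cinner z (\<tau> (v i) (w j))))\<^sup>2) has_sum s) (J \<times> I)"
    by (subst has_sum_swap) (simp add: case_prod_unfold)
  then have s: "((\<lambda>j. Re (cinner (c j) (\<rho> (c j)))) has_sum s) J"
    by (rule has_sum_SigmaD)
      (use dyadic_has_sum_form [OF v] in \<open>simp add: c_def flip: cinner_contract(2)\<close>)
  have "((\<lambda>j. \<Sum>e\<in>E. (cmod (cinner (p e) (w j)))\<^sup>2) has_sum n) J"
    unfolding n_def by (intro has_sum_sum_finite fin dyadic_has_sum_form [OF w])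
  moreover have "(\<Sum>e\<in>E. (cmod (cinner (p e) (w j)))\<^sup>2) = (norm (c j))\<^sup>2" for j
  proof -
    have "cmod (cinner (p e) (w j)) = cmod (cinner e (c j))" for e
      unfolding p_def c_def cinner_contract flip.cinner_contract
      by (metis cinner_commute complex_mod_cnj)
    then show ?thesis
      using parseval [OF E, of "c j"] fin by (simp add: has_sum_finite_iff)
  qed
  ultimately have n: "((\<lambda>j. (norm (c j))\<^sup>2) has_sum n) J"
    by simp
  have "l * n \<le> s"
    by (rule has_sum_mono [OF has_sum_cmult_right [OF n] s]) (rule l)
  moreover have "s \<le> l' * n"
    by (rule has_sum_mono [OF s has_sum_cmult_right [OF n]]) (rule l)
  moreover have p: "(\<Sum>e\<in>E. (norm (p e))\<^sup>2) = (norm z)\<^sup>2"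
    using flip.has_sum_contract [of z] fin by (simp add: p_def has_sum_finite_iff)
  have "k * (norm z)\<^sup>2 \<le> n" "n \<le> k' * (norm z)\<^sup>2"
    unfolding n_def p [symmetric] sum_distrib_left by (intro sum_mono k)+
  then have "l * (k * (norm z)\<^sup>2) \<le> l * n" "l' * n \<le> l' * (k' * (norm z)\<^sup>2)"
    using l by (simp_all add: mult_left_mono)
  ultimately show "l * k * (norm z)\<^sup>2 \<le> Re (cinner z (operator_tensor \<tau> \<rho> \<rho>' z))"
    and "Re (cinner z (operator_tensor \<tau> \<rho> \<rho>' z)) \<le> l' * k' * (norm z)\<^sup>2"
    unfolding s_def by (simp_all add: mult.assoc)
qed

text \<open>Unbiasedness for pure states polarises.\<close>

lemma unbiased_has_sum_0:
  assumes unb: "unbiased \<tau> \<rho>' U X X'" and N: "bounded_clinear (noise \<tau> U X X')"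
    and w: "dyadic \<rho>' J w" and lin: "bounded_clinear \<rho>'"
  shows "((\<lambda>j. cinner (\<tau> x (w j)) (noise \<tau> U X X' (\<tau> y (w j)))) has_sum 0) J"
proof -
  define N where "N = noise \<tau> U X X'"
  define q where "q x y = (\<Sum>\<^sub>\<infinity>j\<in>J. cinner (\<tau> x (w j)) (N (\<tau> y (w j))))" for x y
  note Nlin = bounded_clinearD [OF assms(2), folded N_def]
  have q: "((\<lambda>j. cinner (\<tau> x (w j)) (N (\<tau> y (w j)))) has_sum q x y) J" for x y
    using dyadic_summable [OF w bounded_clinear_tensor(1)
        bounded_clinear_compose [OF assms(2) bounded_clinear_tensor(1)]]
    unfolding q_def by (simp add: N_def)
  have q_eqI: "q x y = s" if "((\<lambda>j. cinner (\<tau> x (w j)) (N (\<tau> y (w j)))) has_sum s) J" for x y s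
    unfolding q_def using that by (rule infsumI)
  have unit: "q x x = 0" if "norm x = 1" for x
  proof -
    have P: "state (\<lambda>y. cinner x y *\<^sub>C x)"
      by (rule state_rank_one [OF that E])
    have "0 = op_trace (operator_tensor \<tau> (\<lambda>y. cinner x y *\<^sub>C x) \<rho>' \<circ> N)"
      using unb P by (simp add: unbiased_def N_def)
    also have "\<dots> = (\<Sum>\<^sub>\<infinity>p\<in>(UNIV :: unit set) \<times> J. cinner (\<tau> x (w (snd p))) (N (\<tau> x (w (snd p)))))"
      using assms(2)
      by (intro op_trace_dyadic(1) [OF dyadic_operator_tensor orthonormal_basis_tensor]
          dyadic_rank_one w bounded_clinear_rank_one lin) (simp add: N_def)
    also have "\<dots> = q x x"
      unfolding q_def by (rule infsum_reindex_bij_betw [of snd "UNIV \<times> J" J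
            "\<lambda>j. cinner (\<tau> x (w j)) (N (\<tau> x (w j)))"])
        (auto simp: bij_betw_def inj_on_def image_iff)
    finally show ?thesis by simp
  qed
  have diag: "q x x = 0" for x
  proof (cases "x = 0")
    case True
    then show ?thesis
      using bounded_clinearD(4) [OF bounded_clinear_tensor(2)] by (simp add: q_def)
  next
    case False
    define r where "r = complex_of_real (norm x)"
    have x: "x = r *\<^sub>C sgn x"
      by (simp add: r_def sgn_div_norm False flip: scaleR_scaleC)
    have "((\<lambda>j. r * (cnj r * cinner (\<tau> (sgn x) (w j)) (N (\<tau> (sgn x) (w j))))) has_sum
        r * (cnj r * q (sgn x) (sgn x))) J"
      by (intro has_sum_cmult_right q)
    then have "q (r *\<^sub>C sgn x) (r *\<^sub>C sgn x) = r * (cnj r * q (sgn x) (sgn x))"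
      by (intro q_eqI) (simp add: tensor_simps Nlin cinner_simps mult_ac)
    then show ?thesis
      using unit [of "sgn x"] False x by (simp add: norm_sgn)
  qed
  have add: "q (x + c *\<^sub>C y) (x + c *\<^sub>C y) = q x x + c * q x y + cnj c * q y x + cnj c * (c * q y y)"
    for c x y
  proof (rule q_eqI)
    have "((\<lambda>j. cinner (\<tau> x (w j)) (N (\<tau> x (w j))) + c * cinner (\<tau> x (w j)) (N (\<tau> y (w j))) +
        cnj c * cinner (\<tau> y (w j)) (N (\<tau> x (w j))) + cnj c * (c * cinner (\<tau> y (w j)) (N (\<tau> y (w j))))) has_sum
      q x x + c * q x y + cnj c * q y x + cnj c * (c * q y y)) J"
      by (intro has_sum_add has_sum_cmult_right q)
    then show "((\<lambda>j. cinner (\<tau> (x + c *\<^sub>C y) (w j)) (N (\<tau> (x + c *\<^sub>C y) (w j)))) has_sum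
      q x x + c * q x y + cnj c * q y x + cnj c * (c * q y y)) J"
      by (simp add: tensor_simps Nlin cinner_simps algebra_simps)
  qed
  \<comment> \<open>The coefficients 1 and \<i> make the sum and the difference of
    \<open>q x y\<close> and \<open>q y x\<close> vanish.\<close>
  have "q x y + q y x = 0" "\<i> * q x y - \<i> * q y x = 0"
    using add [of x 1 y] add [of x \<i> y] diag by simp_all
  then have "q x y = 0"
    by (simp add: complex_eq_iff)
  then show ?thesis
    using q [of x y] by (simp add: N_def)
qed

text \<open>This is the trace of the noise against
  \<open>T \<circ> \<rho> \<circ> cadjoint S\<close> tensored with the apparatus state, where the
  first factor need not be a state. The sum over \<open>j\<close> vanishes for each
  \<open>i\<close>; summability over pairs permits summing in that order.\<close>

lemma unbiased_operators_has_sum_0: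
  fixes S T :: "'h \<Rightarrow> 'h"
  assumes unb: "unbiased \<tau> \<rho>' U X X'" and N: "bounded_clinear (noise \<tau> U X X')"
    and v: "dyadic \<rho> I v" and w: "dyadic \<rho>' J w"
    and lin: "bounded_clinear \<rho>" "bounded_clinear \<rho>'"
    and S: "bounded_clinear S" and T: "bounded_clinear T"
  shows "((\<lambda>p. cinner (\<tau> (S (v (fst p))) (w (snd p)))
    (noise \<tau> U X X' (\<tau> (T (v (fst p))) (w (snd p))))) has_sum 0) (I \<times> J)"
proof -
  let ?f = "\<lambda>p. cinner (\<tau> (S (v (fst p))) (w (snd p)))
    (noise \<tau> U X X' (\<tau> (T (v (fst p))) (w (snd p))))"
  note ot = operator_tensor [OF _ bounded_clinear_id]
  have "?f summable_on I \<times> J"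
    using dyadic_summable [OF dyadic_operator_tensor [OF v w lin] ot(1) [OF S]
        bounded_clinear_compose [OF N ot(1) [OF T]]]
    by (simp add: ot(2) S T)
  then have s: "(?f has_sum infsum ?f (I \<times> J)) (I \<times> J)"
    by simp
  have "((\<lambda>i. 0) has_sum infsum ?f (I \<times> J)) I"
    by (rule has_sum_SigmaD [OF s]) (simp add: unbiased_has_sum_0 [OF unb N w lin(2)])
  then have "infsum ?f (I \<times> J) = 0"
    using has_sum_unique has_sum_0_simp by blast
  with s show ?thesis by simp
qed

end

section \<open>The measurement model\<close>

context tensor_basis
begin

text \<open>The meter observable in the Heisenberg picture, after the interaction.\<close>

definition meter :: "('t \<Rightarrow> 't) \<Rightarrow> ('k \<Rightarrow> 'k) \<Rightarrow> 't \<Rightarrow> 't" where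
  "meter U X' = cadjoint U \<circ> operator_tensor \<tau> id X' \<circ> U"

lemma noise_eq: "noise \<tau> U X X' z = meter U X' z - operator_tensor \<tau> X id z"
  by (simp add: noise_def meter_def)

lemma hermitian_id: "hermitian id"
  by (simp add: hermitian_def bounded_clinear_id)

lemma hermitian_meter:
  assumes U: "unitary U" and X': "hermitian X'"
  shows "hermitian (meter U X')"
proof -
  have bU: "bounded_clinear U" using U by (simp add: unitary_def)
  have T: "hermitian (operator_tensor \<tau> id X')"
    by (rule hermitian_operator_tensor [OF hermitian_id X'])
  show ?thesis
    unfolding hermitian_def
  proof (intro conjI allI)
    show "bounded_clinear (meter U X')"
      unfolding meter_def
      by (intro bounded_clinear_compose bounded_clinear_cadjoint bU hermitianD(1) [OF T])
  qed (simp add: meter_def cinner_cadjoint_left cinner_cadjoint_right bU hermitianD(2) [OF T])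
qed

lemma hermitian_noise:
  assumes U: "unitary U" and X': "hermitian X'" and X: "hermitian X"
  shows "hermitian (noise \<tau> U X X')"
  using hermitian_meter [OF U X'] hermitian_operator_tensor [OF X hermitian_id]
  by (auto simp: hermitian_def noise_eq [abs_def] cinner_simps intro: bounded_clinear_diff)

lemma meter_commute:
  assumes U: "unitary U" and A': "hermitian A'" and B': "hermitian B'"
    and comm: "commutator A' B' = (\<lambda>x. 0)"
  shows "meter U A' (meter U B' z) = meter U B' (meter U A' z)"
proof -
  have "U (cadjoint U z) = z" for z
    using U by (simp add: unitary_def fun_eq_iff)
  moreover have "A' \<circ> B' = B' \<circ> A'"
    using comm by (simp add: commutator_def fun_eq_iff)
  then have "operator_tensor \<tau> id A' \<circ> operator_tensor \<tau> id B' =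
      operator_tensor \<tau> id B' \<circ> operator_tensor \<tau> id A'"
    using hermitianD(1) [OF A'] hermitianD(1) [OF B']
    by (simp add: operator_tensor_compose bounded_clinear_id)
  ultimately show ?thesis
    by (simp add: meter_def fun_eq_iff)
qed

lemma measurement_error_dyadic:
  assumes \<sigma>: "dyadic (operator_tensor \<tau> \<rho> \<rho>') I v" and N: "hermitian (noise \<tau> U X X')"
  shows "measurement_error \<tau> \<rho> \<rho>' U X X' = sqrt (\<Sum>\<^sub>\<infinity>i\<in>I. (norm (noise \<tau> U X X' (v i)))\<^sup>2)"
proof -
  note bN = hermitianD(1) [OF N]
  have "op_trace (operator_tensor \<tau> \<rho> \<rho>' \<circ> (noise \<tau> U X X' \<circ> noise \<tau> U X X')) =
      (\<Sum>\<^sub>\<infinity>i\<in>I. cinner (noise \<tau> U X X' (v i)) (noise \<tau> U X X' (v i)))"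
    using op_trace_dyadic(1) [OF \<sigma> orthonormal_basis_tensor bounded_clinear_compose [OF bN bN]]
    by (simp add: hermitianD(2) [OF N])
  also have "\<dots> = of_real (\<Sum>\<^sub>\<infinity>i\<in>I. (norm (noise \<tau> U X X' (v i)))\<^sup>2)"
    unfolding cinner_self by (intro infsumI has_sum_of_real dyadic_has_sum_norm [OF \<sigma> bN])
  finally show ?thesis
    by (simp add: measurement_error_def)
qed

text \<open>\<open>P + ?A\<close> and \<open>Q + ?B\<close> are the meters and commute. Expanding
  their commutator leaves, besides that of \<open>P\<close> and \<open>Q\<close>, two mixed
  commutators, which unbiasedness annihilates, and that of \<open>A\<close> and \<open>B\<close> on
  the system, whose trace carries the apparatus trace 1.\<close>

lemma noise_commutator:
  assumes herm: "hermitian A" "hermitian B" "hermitian A'" "hermitian B'"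
    and comm: "commutator A' B' = (\<lambda>x. 0)" and U: "unitary U"
    and unb: "unbiased \<tau> \<rho>' U A A'" "unbiased \<tau> \<rho>' U B B'"
    and v: "dyadic \<rho> I v" and w: "dyadic \<rho>' J w"
    and lin: "bounded_clinear \<rho>" "bounded_clinear \<rho>'" and tr: "op_trace \<rho>' = 1"
  shows "(\<Sum>\<^sub>\<infinity>p\<in>I \<times> J. cinner (\<tau> (v (fst p)) (w (snd p)))
      (noise \<tau> U A A' (noise \<tau> U B B' (\<tau> (v (fst p)) (w (snd p)))) -
       noise \<tau> U B B' (noise \<tau> U A A' (\<tau> (v (fst p)) (w (snd p)))))) =
    - expectation \<rho> (commutator A B)"
proof -
  define P Q where "P = noise \<tau> U A A'" and "Q = noise \<tau> U B B'"
  define u where "u p = \<tau> (v (fst p)) (w (snd p))" for p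
  define C where "C = commutator A B"
  have P: "hermitian P" and Q: "hermitian Q"
    unfolding P_def Q_def by (intro hermitian_noise herm U)+
  note bA = hermitianD(1) [OF herm(1)] and bB = hermitianD(1) [OF herm(2)]
  note linA = bounded_clinearD [OF hermitianD(1) [OF hermitian_meter [OF U herm(3)]]]
    and linB = bounded_clinearD [OF hermitianD(1) [OF hermitian_meter [OF U herm(4)]]]
  have otA: "operator_tensor \<tau> A id (\<tau> x y) = \<tau> (A x) y"
    and otB: "operator_tensor \<tau> B id (\<tau> x y) = \<tau> (B x) y" for x y
    using operator_tensor(2) [OF bA bounded_clinear_id] operator_tensor(2) [OF bB bounded_clinear_id]
    by simp_all
  note linP = bounded_clinearD [OF hermitianD(1) [OF P]]
    and linQ = bounded_clinearD [OF hermitianD(1) [OF Q]]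
    and linA1 = bounded_clinearD [OF operator_tensor(1) [OF bA bounded_clinear_id]]
    and linB1 = bounded_clinearD [OF operator_tensor(1) [OF bB bounded_clinear_id]]
  let ?A = "operator_tensor \<tau> A id" and ?B = "operator_tensor \<tau> B id"
  have bC: "bounded_clinear C"
    using bounded_clinear_diff [OF bounded_clinear_compose [OF bA bB] bounded_clinear_compose [OF bB bA]]
    by (simp add: C_def commutator_def [abs_def])
  have expand: "P (Q z) - Q (P z) = - (P (?B z) - ?B (P z)) - (?A (Q z) - Q (?A z)) - (?A (?B z) - ?B (?A z))"
    for z
  proof -
    have "P (Q z) - Q (P z) + (P (?B z) - ?B (P z)) + (?A (Q z) - Q (?A z)) + (?A (?B z) - ?B (?A z)) =
        meter U A' (meter U B' z) - meter U B' (meter U A' z)"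
      by (simp add: P_def Q_def noise_eq linA linB linA1 linB1 algebra_simps)
    also have "\<dots> = 0"
      using meter_commute [OF U herm(3,4) comm] by simp
    finally show ?thesis
      by (simp add: algebra_simps eq_neg_iff_add_eq_0)
  qed
  \<comment> \<open>Self-adjointness moves \<open>?A\<close> and \<open>?B\<close> onto the system
    vectors; each mixed term then has the shape killed by unbiasedness, with one of its two system
    operators the identity.\<close>
  have summand: "cinner (u p) (P (Q (u p)) - Q (P (u p))) =
      (cinner (\<tau> (B (v (fst p))) (w (snd p))) (P (u p)) - cinner (u p) (P (\<tau> (B (v (fst p))) (w (snd p)))))
      - (cinner (\<tau> (A (v (fst p))) (w (snd p))) (Q (u p)) - cinner (u p) (Q (\<tau> (A (v (fst p))) (w (snd p)))))
      - cinner (v (fst p)) (C (v (fst p))) * cinner (w (snd p)) (w (snd p))" for p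
  proof -
    have adjA: "cinner z (?A z') = cinner (?A z) z'" and adjB: "cinner z (?B z') = cinner (?B z) z'" for z z'
      using hermitianD(2) [OF hermitian_operator_tensor [OF herm(1) hermitian_id]]
        hermitianD(2) [OF hermitian_operator_tensor [OF herm(2) hermitian_id]] by simp_all
    have "cinner (u p) (?A (?B (u p)) - ?B (?A (u p))) = cinner (v (fst p)) (C (v (fst p))) * cinner (w (snd p)) (w (snd p))"
      by (simp add: u_def otA otB C_def commutator_def cinner_simps cinner_tensor algebra_simps)
    moreover have "cinner (u p) (P (?B (u p))) = cinner (u p) (P (\<tau> (B (v (fst p))) (w (snd p))))"
      "cinner (u p) (?B (P (u p))) = cinner (\<tau> (B (v (fst p))) (w (snd p))) (P (u p))"
      "cinner (u p) (?A (Q (u p))) = cinner (\<tau> (A (v (fst p))) (w (snd p))) (Q (u p))"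
      "cinner (u p) (Q (?A (u p))) = cinner (u p) (Q (\<tau> (A (v (fst p))) (w (snd p))))"
      unfolding adjA adjB by (simp_all add: u_def otA otB)
    ultimately show ?thesis
      unfolding expand by (simp add: cinner_simps)
  qed
  note zero = unbiased_operators_has_sum_0 [OF unb(1) hermitianD(1) [OF P, unfolded P_def] v w lin, folded P_def]
    unbiased_operators_has_sum_0 [OF unb(2) hermitianD(1) [OF Q, unfolded Q_def] v w lin, folded Q_def]
  have "((\<lambda>p. cinner (v (fst p)) (C (v (fst p))) * cinner (w (snd p)) (w (snd p))) has_sum
      expectation \<rho> C) (I \<times> J)"
  proof (rule has_sum_SigmaI)
    have W: "((\<lambda>j. cinner (w j) (w j)) has_sum 1) J"
      using has_sum_infsum [OF dyadic_summable [OF w bounded_clinear_id bounded_clinear_id]]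
        op_trace_dyadic(1) [OF w F bounded_clinear_id] tr by simp
    show "((\<lambda>j. cinner (v (fst (i, j))) (C (v (fst (i, j)))) * cinner (w (snd (i, j))) (w (snd (i, j)))) has_sum
        cinner (v i) (C (v i))) J" for i
      using has_sum_cmult_right [OF W, of "cinner (v i) (C (v i))"] by simp
    show "((\<lambda>i. cinner (v i) (C (v i))) has_sum expectation \<rho> C) I"
      using has_sum_infsum [OF dyadic_summable [OF v bounded_clinear_id bC]]
        op_trace_dyadic(2) [OF v E bC] by (simp add: expectation_def)
    have "(\<lambda>p. cinner (u p) (operator_tensor \<tau> C id (u p))) summable_on I \<times> J"
      using dyadic_summable [OF dyadic_operator_tensor [OF v w lin] bounded_clinear_id
          operator_tensor(1) [OF bC bounded_clinear_id]] by (simp add: u_def)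
    then show "(\<lambda>p. cinner (v (fst p)) (C (v (fst p))) * cinner (w (snd p)) (w (snd p))) summable_on I \<times> J"
      by (simp add: u_def operator_tensor(2) [OF bC bounded_clinear_id] cinner_tensor)
  qed
  then have "((\<lambda>p. cinner (u p) (P (Q (u p)) - Q (P (u p)))) has_sum
      (0 - 0) - (0 - 0) - expectation \<rho> C) (I \<times> J)"
    unfolding summand unfolding u_def
    using zero(1) [OF bounded_clinear_id bB] zero(1) [OF bB bounded_clinear_id]
      zero(2) [OF bA bounded_clinear_id] zero(2) [OF bounded_clinear_id bA]
    by (intro has_sum_diff) simp_all
  then show ?thesis
    unfolding P_def [symmetric] Q_def [symmetric] u_def [symmetric] C_def [symmetric]
    by (intro infsumI) simp
qed

end

section \<open>The inequality, in finite and in infinite dimension\<close>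

lemma state_smallest_eigenvalue:
  fixes \<rho> :: "'a::hilbert_space \<Rightarrow> 'a"
  assumes "positive_semidefinite \<rho>" "orthonormal_basis E" "((\<lambda>e. cinner e (\<rho> e)) has_sum 1) E"
  shows "infinite E \<Longrightarrow> smallest_eigenvalue \<rho> = 0" "E \<noteq> {}"
proof -
  show "smallest_eigenvalue \<rho> = 0" if "infinite E"
    using assms that has_sum_imp_summable [OF has_sum_Re [OF assms(3)]]
    by (intro infinite_dimensional_smallest_eigenvalue) auto
  show "E \<noteq> {}"
  proof
    assume "E = {}"
    then show False
      using has_sum_unique [OF assms(3), of 0] by simp
  qed
qed

theorem mainTheorem4:
  fixes \<tau> :: "'h::separable_hilbert_space \<Rightarrow> 'k::separable_hilbert_space \<Rightarrow> 't::hilbert_space"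
    and \<rho> A B :: "'h \<Rightarrow> 'h"
    and \<rho>\<^sub>a\<^sub>p\<^sub>p A\<^sub>a\<^sub>p\<^sub>p B\<^sub>a\<^sub>p\<^sub>p :: "'k \<Rightarrow> 'k"
    and U :: "'t \<Rightarrow> 't"
    and lmax lmin mumax mumin :: real
  assumes "hilbert_tensor \<tau>"
    and "state \<rho>" and "state \<rho>\<^sub>a\<^sub>p\<^sub>p"
    and "lmax = largest_eigenvalue \<rho>" and "lmin = smallest_eigenvalue \<rho>"
    and "mumax = largest_eigenvalue \<rho>\<^sub>a\<^sub>p\<^sub>p" and "mumin = smallest_eigenvalue \<rho>\<^sub>a\<^sub>p\<^sub>p"
    and "lmax * mumax \<noteq> lmin * mumin"
    and "hermitian A" and "hermitian B"
    and "hermitian A\<^sub>a\<^sub>p\<^sub>p" and "hermitian B\<^sub>a\<^sub>p\<^sub>p"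
    and "commutator A\<^sub>a\<^sub>p\<^sub>p B\<^sub>a\<^sub>p\<^sub>p = (\<lambda>x. 0)"
    and "unitary U"
    and "unbiased \<tau> \<rho>\<^sub>a\<^sub>p\<^sub>p U A A\<^sub>a\<^sub>p\<^sub>p" and "unbiased \<tau> \<rho>\<^sub>a\<^sub>p\<^sub>p U B B\<^sub>a\<^sub>p\<^sub>p"
  shows "measurement_error \<tau> \<rho> \<rho>\<^sub>a\<^sub>p\<^sub>p U A A\<^sub>a\<^sub>p\<^sub>p * measurement_error \<tau> \<rho> \<rho>\<^sub>a\<^sub>p\<^sub>p U B B\<^sub>a\<^sub>p\<^sub>p
    \<ge> (lmax * mumax + lmin * mumin) / (2 * (lmax * mumax - lmin * mumin))
        * cmod (expectation \<rho> (commutator A B))"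
proof -
  obtain E and v :: "nat \<Rightarrow> 'h" where E: "orthonormal_basis E"
    and tr: "((\<lambda>e. cinner e (\<rho> e)) has_sum 1) E" and v: "dyadic \<rho> UNIV v"
    using state_dyadic [OF assms(2)] by blast
  obtain F and w :: "nat \<Rightarrow> 'k" where F: "orthonormal_basis F"
    and tr': "((\<lambda>e. cinner e (\<rho>\<^sub>a\<^sub>p\<^sub>p e)) has_sum 1) F" and w: "dyadic \<rho>\<^sub>a\<^sub>p\<^sub>p UNIV w"
    using state_dyadic [OF assms(3)] by blast
  interpret tensor_basis \<tau> E F
    by unfold_locales (fact assms(1) E F)+
  have pos: "positive_semidefinite \<rho>" "positive_semidefinite \<rho>\<^sub>a\<^sub>p\<^sub>p" and tr1: "op_trace \<rho>\<^sub>a\<^sub>p\<^sub>p = 1"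
    using assms(2,3) by (simp_all add: state_def)
  note lin = positive_semidefiniteD(2) [OF pos(1)] positive_semidefiniteD(2) [OF pos(2)]
  define u where "u p = \<tau> (v (fst p)) (w (snd p))" for p
  have \<sigma>: "dyadic (operator_tensor \<tau> \<rho> \<rho>\<^sub>a\<^sub>p\<^sub>p) (UNIV \<times> UNIV) u"
    unfolding u_def by (rule dyadic_operator_tensor [OF v w lin])
  define P Q where "P = noise \<tau> U A A\<^sub>a\<^sub>p\<^sub>p" and "Q = noise \<tau> U B B\<^sub>a\<^sub>p\<^sub>p"
  have P: "hermitian P" and Q: "hermitian Q"
    unfolding P_def Q_def by (intro hermitian_noise assms)+
  define \<epsilon> where "\<epsilon> = measurement_error \<tau> \<rho> \<rho>\<^sub>a\<^sub>p\<^sub>p U A A\<^sub>a\<^sub>p\<^sub>p * measurement_error \<tau> \<rho> \<rho>\<^sub>a\<^sub>p\<^sub>p U B B\<^sub>a\<^sub>p\<^sub>p"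
  define c where "c = cmod (expectation \<rho> (commutator A B))"
  have key: "(M + m) * c \<le> 2 * (M - m) * \<epsilon>" if "0 \<le> m" "m < M"
    and "\<And>Z. bounded_clinear Z \<Longrightarrow> m * (\<Sum>\<^sub>\<infinity>p\<in>UNIV\<times>UNIV. (norm (Z (u p)))\<^sup>2) \<le>
      M * (\<Sum>\<^sub>\<infinity>p\<in>UNIV\<times>UNIV. (norm (cadjoint Z (u p)))\<^sup>2)" for m M
    using weighted_uncertainty [OF \<sigma> P Q that] noise_commutator [OF assms(9-16) v w lin tr1]
      measurement_error_dyadic [OF \<sigma> P [unfolded P_def]] measurement_error_dyadic [OF \<sigma> Q [unfolded Q_def]]
    by (simp add: \<epsilon>_def c_def flip: P_def Q_def u_def)
  \<comment> \<open>The trace estimate is for two finite-dimensional factors; a single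
    infinite-dimensional one already makes \<open>lmin * mumin\<close> vanish.\<close>
  have "(lmax * mumax + lmin * mumin) / (2 * (lmax * mumax - lmin * mumin)) * c \<le> \<epsilon>"
  proof (cases "finite E \<and> finite F")
    case True
    then have fin: "finite E" "finite F" "E \<noteq> {}" "F \<noteq> {}"
      using state_smallest_eigenvalue(2) [OF pos(1) E tr] state_smallest_eigenvalue(2) [OF pos(2) F tr']
      by auto
    note l = finite_dimensional_extreme_eigenvalues [OF pos(1) E fin(1,3), folded assms(4,5)]
    note k = finite_dimensional_extreme_eigenvalues [OF pos(2) F fin(2,4), folded assms(6,7)]
    obtain e f where "e \<in> E" "f \<in> F" using fin by blast
    then have "lmin \<le> lmax" "mumin \<le> mumax"
      using l(1,2) [of e] k(1,2) [of f] norm_orthonormal_basis [OF E] norm_orthonormal_basis [OF F]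
      by force+
    then have le: "0 \<le> lmax" "0 \<le> mumax" "lmin * mumin \<le> lmax * mumax"
      using l(3) k(3) by (auto intro: mult_mono)
    \<comment> \<open>The assumption that the two products differ makes the comparison strict and
      the denominator positive.\<close>
    then have less: "0 \<le> lmin * mumin" "lmin * mumin < lmax * mumax"
      using assms(8) l(3) k(3) by auto
    note bounds = operator_tensor_form_bounds [OF v w lin fin(1) l(1,2,3) le(1) k(1,2)]
    have "(lmax * mumax + lmin * mumin) * c \<le> 2 * (lmax * mumax - lmin * mumin) * \<epsilon>"
    proof (rule key [OF less])
      fix Z :: "'t \<Rightarrow> 't" assume "bounded_clinear Z"
      then show "lmin * mumin * (\<Sum>\<^sub>\<infinity>p\<in>UNIV\<times>UNIV. (norm (Z (u p)))\<^sup>2) \<le>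
          lmax * mumax * (\<Sum>\<^sub>\<infinity>p\<in>UNIV\<times>UNIV. (norm (cadjoint Z (u p)))\<^sup>2)"
        using bounds le less fin
        by (intro finite_dimensional_trace_bound [OF \<sigma> orthonormal_basis_tensor]) auto
    qed
    then show ?thesis
      using less by (simp add: divide_le_eq mult.commute)
  next
    case False
    then have "lmin = 0 \<or> mumin = 0"
      using state_smallest_eigenvalue(1) [OF pos(1) E tr] state_smallest_eigenvalue(1) [OF pos(2) F tr']
      by (auto simp: assms(5,7))
    then have zero: "lmin * mumin = 0"
      by simp
    \<comment> \<open>For \<open>m = 0\<close> the condition on \<open>Z\<close> is trivial and
      \<open>M\<close> cancels, so \<open>M = 1\<close> serves. In the claimed constant
      \<open>lmax * mumax\<close>, nonzero by assumption, cancels as well and leaves 1/2.\<close>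
    have "(1 + 0) * c \<le> 2 * (1 - 0) * \<epsilon>"
      by (rule key) (simp_all add: infsum_nonneg)
    then show ?thesis
      unfolding zero using assms(8) [unfolded zero] by simp
  qed
  then show ?thesis
    by (simp add: \<epsilon>_def c_def)
qed

end
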